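(* For every integer $N \ge 0$ and every graph $G$ on $N$ vertices, the number of inclusion-maximal sets $S \subseteq V(G)$ such that the induced subgraph $G[S]$ has maximum degree at most $1$ is at most $10^{N/5}$. In other words, $\mathcal{M}_1(N) \le 10^{N/5} \le 1.585^{N}$.
   Context: Graphs are finite, simple and undirected. For an integer $d\ge 0$, $\mathcal{M}_d(N)$ denotes the maximum, over all graphs $G$ on $N$ vertices, of the number of inclusion-maximal sets $S\subseteq V(G)$ such that $G[S]$ has maximum degree at most $d$. *)

theory Defs
  imports Complex_Main "Graph_Theory.Graph_Theory"
begin

text \<open>
  A finite simple undirected graph is a \<^const>\<open>pair_graph\<close>: a finite loop-free symmetric digraph
  without parallel arcs, an undirected edge being the pair of its two orientations.  Hence the
  degree of a vertex is its out-degree.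
\<close>

text \<open>The inserted \<open>0\<close> makes the maximum degree of the null graph \<open>0\<close>.\<close>

definition max_degree :: "('a, 'b) pre_digraph \<Rightarrow> nat" where
  "max_degree H = Max (insert 0 (out_degree H ` verts H))"

definition bounded_degree_sets :: "nat \<Rightarrow> 'a pair_pre_digraph \<Rightarrow> 'a set set" where
  "bounded_degree_sets d G = {S. S \<subseteq> pverts G \<and> max_degree (with_proj G \<restriction> S) \<le> d}"

definition maximal_bounded_degree_sets :: "nat \<Rightarrow> 'a pair_pre_digraph \<Rightarrow> 'a set set" where
  "maximal_bounded_degree_sets d G =
     {S \<in> bounded_degree_sets d G. \<not> (\<exists>T \<in> bounded_degree_sets d G. S \<subset> T)}"

text \<open>
  Every finite graph is isomorphic to one whose vertices are natural numbers, so restricting the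
  vertex type loses nothing (\<open>card_maximal_bounded_degree_sets_le\<close> below); the maximum is over a
  finite nonempty set (\<open>finite_graph_counts\<close>, \<open>graph_counts_nonempty\<close>).
\<close>

definition graph_counts :: "nat \<Rightarrow> nat \<Rightarrow> nat set" where
  "graph_counts d N =
     {card (maximal_bounded_degree_sets d G) | G :: nat pair_pre_digraph.
        pair_graph G \<and> card (pverts G) = N}"

definition max_count :: "nat \<Rightarrow> nat \<Rightarrow> nat" (\<open>\<M>\<^bsub>_\<^esub>'(_')\<close>) where
  "\<M>\<^bsub>d\<^esub>(N) = Max (graph_counts d N)"

lemma max_degree_le_iff:
  assumes "finite (verts H)"
  shows "max_degree H \<le> d \<longleftrightarrow> (\<forall>v \<in> verts H. out_degree H v \<le> d)"
  using assms by (simp add: max_degree_def)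

lemma pair_graph_finite_verts: "pair_graph G \<Longrightarrow> finite (pverts G)"
  by (rule pair_fin_digraph.pair_finite_verts)
     (simp add: pair_graph_def pair_digraph_def)

lemma maximal_bounded_degree_sets_subset_Pow:
  "maximal_bounded_degree_sets d G \<subseteq> Pow (pverts G)"
  by (auto simp: maximal_bounded_degree_sets_def bounded_degree_sets_def)

lemma finite_graph_counts: "finite (graph_counts d N)"
proof (rule finite_subset)
  show "graph_counts d N \<subseteq> {..2 ^ N}"
  proof
    fix k assume "k \<in> graph_counts d N"
    then obtain G :: "nat pair_pre_digraph" where
      G: "pair_graph G" "card (pverts G) = N" "k = card (maximal_bounded_degree_sets d G)"
      by (auto simp: graph_counts_def)
    have fin: "finite (pverts G)" using G(1) by (rule pair_graph_finite_verts)
    then have "k \<le> card (Pow (pverts G))"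
      unfolding G(3) by (intro card_mono maximal_bounded_degree_sets_subset_Pow) simp
    with fin G(2) show "k \<in> {..2 ^ N}" by (simp add: card_Pow)
  qed
qed simp

lemma graph_counts_nonempty: "graph_counts d N \<noteq> {}"
proof -
  have "pair_graph \<lparr>pverts = {..<N}, parcs = {}\<rparr>"
    by unfold_locales (auto simp: symmetric_def sym_def)
  then show ?thesis unfolding graph_counts_def by fastforce
qed

lemma out_degree_with_proj_induce:
  "out_degree (with_proj G \<restriction> S) v = card {u \<in> S. v \<in> S \<and> (v, u) \<in> parcs G}"
proof -
  have "out_arcs (with_proj G \<restriction> S) v = Pair v ` {u \<in> S. v \<in> S \<and> (v, u) \<in> parcs G}"
    by (auto simp: out_arcs_def)
  then show ?thesis by (simp add: out_degree_def card_image inj_on_def)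
qed

lemma card_maximal_bounded_degree_sets_le:
  fixes G :: "'a pair_pre_digraph"
  assumes G: "pair_graph G"
  shows "card (maximal_bounded_degree_sets d G) \<le> \<M>\<^bsub>d\<^esub>(card (pverts G))"
proof -
  interpret G: pair_graph G by (rule G)
  have fin: "finite (pverts G)" using G by (rule pair_graph_finite_verts)
  obtain f :: "'a \<Rightarrow> nat" where inj: "inj_on f (pverts G)"
    using finite_imp_inj_to_nat_seg[OF fin] by auto
  define H where "H = \<lparr>pverts = f ` pverts G, parcs = map_prod f f ` parcs G\<rparr>"
  have wf: "a \<in> pverts G" "b \<in> pverts G" if "(a, b) \<in> parcs G" for a b
    using that by (auto dest: G.in_arcsD1 G.in_arcsD2)
  have symG: "(b, a) \<in> parcs G" if "(a, b) \<in> parcs G" for a b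
    using G.pair_sym_arcs that by (auto simp: symmetric_def sym_def)
  have arc: "(f a, f b) \<in> parcs H \<longleftrightarrow> (a, b) \<in> parcs G"
    if "a \<in> pverts G" "b \<in> pverts G" for a b
  proof
    assume "(f a, f b) \<in> parcs H"
    then obtain x y where xy: "(x, y) \<in> parcs G" "f x = f a" "f y = f b"
      by (auto simp: H_def)
    with wf[OF xy(1)] that have "x = a" "y = b" by (auto dest: inj_onD[OF inj])
    with xy show "(a, b) \<in> parcs G" by simp
  qed (force simp: H_def)
  have H: "pair_graph H"
  proof
    show "fst e \<in> pverts H" "snd e \<in> pverts H" if "e \<in> parcs H" for e
      using that wf by (auto simp: H_def)
    show "finite (pverts H)" "finite (parcs H)"
      using fin G.pair_finite_arcs by (auto simp: H_def)
    show "fst e \<noteq> snd e" if "e \<in> parcs H" for e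
    proof -
      from that obtain x y where xy: "(x, y) \<in> parcs G" "e = (f x, f y)"
        by (auto simp: H_def)
      then show ?thesis
        using wf[OF xy(1)] G.pair_no_loops[OF xy(1)] by (auto dest: inj_onD[OF inj])
    qed
    show "symmetric (with_proj H)"
      using symG by (force simp: symmetric_def sym_def H_def)
  qed
  have cardH: "card (pverts H) = card (pverts G)"
    using inj by (simp add: H_def card_image)
  have deg: "out_degree (with_proj H \<restriction> (f ` S)) (f v) = out_degree (with_proj G \<restriction> S) v"
    if S: "S \<subseteq> pverts G" "v \<in> S" for S v
  proof -
    have "{u \<in> f ` S. f v \<in> f ` S \<and> (f v, u) \<in> parcs H} = f ` {u \<in> S. v \<in> S \<and> (v, u) \<in> parcs G}"
      using S arc by blast
    moreover have "inj_on f {u \<in> S. v \<in> S \<and> (v, u) \<in> parcs G}"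
      using S by (auto intro: inj_on_subset[OF inj])
    ultimately show ?thesis by (simp add: out_degree_with_proj_induce card_image)
  qed
  have mdeg: "max_degree (with_proj H \<restriction> (f ` S)) = max_degree (with_proj G \<restriction> S)"
    if "S \<subseteq> pverts G" for S
    using deg[OF that] by (simp add: max_degree_def image_image cong: image_cong_simp)
  have bds: "bounded_degree_sets d H = image f ` bounded_degree_sets d G"
  proof (intro set_eqI iffI)
    fix T assume T: "T \<in> bounded_degree_sets d H"
    then obtain S where "S \<subseteq> pverts G" "T = f ` S"
      by (auto simp: bounded_degree_sets_def H_def subset_image_iff)
    with T mdeg show "T \<in> image f ` bounded_degree_sets d G"
      by (auto simp: bounded_degree_sets_def)
  next
    fix T assume "T \<in> image f ` bounded_degree_sets d G"
    then show "T \<in> bounded_degree_sets d H"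
      using mdeg by (auto simp: bounded_degree_sets_def) (auto simp: H_def)
  qed
  have le: "f ` S \<subseteq> f ` T \<longleftrightarrow> S \<subseteq> T" if "S \<subseteq> pverts G" "T \<subseteq> pverts G" for S T
  proof
    assume fS: "f ` S \<subseteq> f ` T"
    show "S \<subseteq> T"
    proof
      fix x assume x: "x \<in> S"
      with fS have "f x \<in> f ` T" by auto
      with x that show "x \<in> T" using inj_on_image_mem_iff[OF inj, of x T] by blast
    qed
  qed auto
  have sub: "f ` S \<subset> f ` T \<longleftrightarrow> S \<subset> T" if "S \<subseteq> pverts G" "T \<subseteq> pverts G" for S T
    using le[OF that] le[OF that(2,1)] by (simp add: less_le_not_le)
  have B: "S \<subseteq> pverts G" if "S \<in> bounded_degree_sets d G" for S
    using that by (simp add: bounded_degree_sets_def)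
  have ex: "(\<exists>T \<in> image f ` bounded_degree_sets d G. f ` S \<subset> T) \<longleftrightarrow>
      (\<exists>T \<in> bounded_degree_sets d G. S \<subset> T)" if "S \<in> bounded_degree_sets d G" for S
    unfolding bex_simps by (rule bex_cong) (simp_all add: sub B that)
  have "maximal_bounded_degree_sets d H = image f ` maximal_bounded_degree_sets d G"
    proof -
    have filter_image: "{T \<in> g ` A. P T} = g ` {S \<in> A. Q S}"
      if "\<And>S. S \<in> A \<Longrightarrow> P (g S) \<longleftrightarrow> Q S" for g :: "'a set \<Rightarrow> nat set" and A P Q
      using that by blast
    show ?thesis
      unfolding maximal_bounded_degree_sets_def bds by (rule filter_image, subst ex) simp_all
  qed
  moreover have "inj_on (image f) (maximal_bounded_degree_sets d G)"
    using inj_on_image_Pow[OF inj] maximal_bounded_degree_sets_subset_Pow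
    by (rule inj_on_subset)
  ultimately have "card (maximal_bounded_degree_sets d H) = card (maximal_bounded_degree_sets d G)"
    by (simp add: card_image)
  then have "card (maximal_bounded_degree_sets d G) \<in> graph_counts d (card (pverts G))"
    unfolding graph_counts_def by (intro CollectI exI[of _ H]) (simp add: H cardH)
  then show ?thesis
    unfolding max_count_def by (intro Max_ge finite_graph_counts)
qed

end

theory Submission
  imports Defs
begin

text \<open>
  Let \<open>x = 10 powr (1/5)\<close>, \<open>q = 1/x\<close>, and let \<open>m V\<close> be the number of maximal dissociation sets (induced
  maximum degree at most 1) of the graph induced on \<open>V\<close>.  The bound \<open>m V \<le> x ^ |V|\<close> is proved by
  induction on \<open>V\<close>.  A maximal set avoiding \<open>v\<close> is maximal in \<open>V - v\<close>; removing a component \<open>A\<close> (a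
  vertex or an edge) of a maximal set leaves a maximal set of \<open>V - N[A]\<close>.  Hence
  \<open>m V \<le> m (V - v) + i(v) + \<Sum>u. m (V - N[v, u])\<close>, where \<open>u\<close> runs over the neighbours of \<open>v\<close> and \<open>i(v)\<close>
  counts the maximal sets in which \<open>v\<close> is isolated.  By maximality such a set meets \<open>N(u) - N[v]\<close>
  for every neighbour \<open>u\<close>, so \<open>i(v) = 0\<close> if one of these differences is empty, and singleton
  differences force vertices into the set; one forced vertex gains a factor \<open>2 q^2\<close>, two forced
  vertices gain \<open>4 q^4\<close>.  With these gains the branching inequality closes the induction at a vertex
  of maximum degree (or at a twin of it) if that degree is at least 3, unless its closed neighbourhood
  is a component on 4 or 5 vertices; there rounding down the inductive bound suffices, because \<open>x^3 < 4\<close> and \<open>x^4 < 7\<close> give at most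
  \<open>3 + 3 = 6 \<le> x^4\<close> and \<open>6 + 4 = 10 = x^5\<close> sets.  Vertices of degree at most 1 gain a factor directly, and
  only disjoint unions of cycles remain.
\<close>

section \<open>The base \<open>growth\<close>, its reciprocal \<open>shrink\<close>, and decimal
  bounds on their powers\<close>

definition growth :: real where
  "growth = 10 powr (1 / 5)"

definition shrink :: real where
  "shrink = 1 / growth"

lemma growth_pos: "growth > 0"
  by (simp add: growth_def)

lemma growth_power_5: "growth ^ 5 = 10"
  unfolding growth_def by (subst powr_power) auto

lemma growth_power: "growth ^ n = 10 powr (real n / 5)"
  unfolding growth_def by (subst powr_power) auto

lemma growth_le: "growth \<le> 1.585"
proof (rule ccontr)
  assume "\<not> growth \<le> 1.585"
  then have "1.585 ^ 5 < growth ^ 5"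
    by (intro power_strict_mono) auto
  then show False unfolding growth_power_5 by (simp add: power_numeral_reduce)
qed

lemma growth_lower: "1.58 \<le> growth"
proof (rule ccontr)
  assume "\<not> 1.58 \<le> growth"
  then have "growth ^ 5 < 1.58 ^ 5"
    using growth_pos by (intro power_strict_mono) auto
  then show False unfolding growth_power_5 by (simp add: power_numeral_reduce)
qed

lemma growth_powers: "growth ^ 3 < 4" "6 \<le> growth ^ 4" "growth ^ 4 < 7"
  using power_mono[OF growth_le, of 3] power_mono[OF growth_le, of 4]
    power_mono[OF growth_lower, of 4] growth_pos
  by (simp_all add: power_numeral_reduce)

lemma growth_ge_1: "1 \<le> growth"
  unfolding growth_def by (rule ge_one_powr_ge_zero) auto

lemma shrink_pos: "shrink > 0"
  using growth_pos by (simp add: shrink_def)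

lemma shrink_growth: "shrink ^ k * growth ^ k = 1"
  using growth_pos by (simp add: shrink_def power_divide)

lemma shrink_power_5: "shrink ^ 5 = 1 / 10"
  unfolding shrink_def power_divide growth_power_5 by simp

lemma shrink_upper: "shrink \<le> 0.63096"
proof (rule ccontr)
  assume "\<not> shrink \<le> 0.63096"
  then have "0.63096 ^ 5 < shrink ^ 5"
    by (intro power_strict_mono) auto
  then show False unfolding shrink_power_5 by (simp add: power_numeral_reduce)
qed

lemma shrink_lower: "0.63 \<le> shrink"
proof (rule ccontr)
  assume "\<not> 0.63 \<le> shrink"
  then have "shrink ^ 5 < 0.63 ^ 5"
    using shrink_pos by (intro power_strict_mono) auto
  then show False unfolding shrink_power_5 by (simp add: power_numeral_reduce)
qed

lemma shrink_le_1: "shrink \<le> 1"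
  using shrink_upper by simp

text \<open>With the powers of q as independent atoms, these decimals turn the branching
  inequalities into linear arithmetic. The fifth power is absent because it equals 1/10
  exactly.\<close>

lemma shrink_powers_upper:
  "shrink ^ 2 \<le> 0.39812" "shrink ^ 3 \<le> 0.2512" "shrink ^ 4 \<le> 0.1585"
  "shrink ^ 6 \<le> 0.0631" "shrink ^ 7 \<le> 0.0399" "shrink ^ 8 \<le> 0.02512"
proof -
  have le: "shrink ^ k \<le> 0.63096 ^ k" for k
    using shrink_upper shrink_pos by (intro power_mono) auto
  show "shrink ^ 2 \<le> 0.39812" "shrink ^ 3 \<le> 0.2512" "shrink ^ 4 \<le> 0.1585"
    "shrink ^ 6 \<le> 0.0631" "shrink ^ 7 \<le> 0.0399" "shrink ^ 8 \<le> 0.02512"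
    using le[of 2] le[of 3] le[of 4] le[of 6] le[of 7] le[of 8]
    by (simp_all add: power_numeral_reduce)
qed

lemmas shrink_bounds = shrink_upper[simplified] shrink_powers_upper[simplified] shrink_power_5

lemma shrink_power_antimono: "j \<le> k \<Longrightarrow> shrink ^ k \<le> shrink ^ j"
  using shrink_pos shrink_le_1 by (intro power_decreasing) auto

text \<open>The ratio of consecutive terms is (k+1) q / k, which is at most 3q/2 < 1 for k >=
  2.\<close>

lemma linear_shrink_antimono:
  assumes "2 \<le> j" "j \<le> k"
  shows "real k * shrink ^ k \<le> real j * shrink ^ j"
  using assms(2)
proof (induction k rule: dec_induct)
  case (step k)
  have "real (Suc k) * shrink \<le> real (Suc k) * 0.63096"
    using shrink_upper by (intro mult_left_mono) auto
  also have "\<dots> \<le> real k" using step(1) assms(1) by simp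
  finally have "real (Suc k) * shrink * shrink ^ k \<le> real k * shrink ^ k"
    using shrink_pos by (intro mult_right_mono) auto
  then show ?case using step(3) by (simp add: mult.assoc)
qed simp

text \<open>The maximum of k q^k is at k = 2: the sequence falls from there on, and q <= 2 q^2
  because q >= 1/2. Such products arise when k branches delete at least k vertices each.\<close>

lemma linear_shrink_le:
  assumes "1 \<le> k"
  shows "real k * shrink ^ k \<le> 2 * shrink ^ 2"
proof (cases "k = 1")
  case True
  have "shrink * 1 \<le> shrink * (2 * shrink)"
    using shrink_lower by (intro mult_left_mono) auto
  then show ?thesis using True by (simp add: power2_eq_square)
next
  case False
  then show ?thesis using linear_shrink_antimono[of 2 k] assms by simp
qed

text \<open>Lets a vertex without neighbours be charged the same factor as a leaf. Division by q
  reduces it to 1 <= q + 2 q^2.\<close>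

lemma shrink_le_leaf_factor: "shrink \<le> shrink ^ 2 + 2 * shrink ^ 3"
proof -
  have "1 \<le> shrink + 2 * shrink ^ 2"
    using power_mono[OF shrink_lower, of 2] shrink_lower by (simp add: power2_eq_square)
  then have "shrink * 1 \<le> shrink * (shrink + 2 * shrink ^ 2)"
    using shrink_pos by (intro mult_left_mono) auto
  then show ?thesis by (simp add: algebra_simps power_numeral_reduce)
qed

lemma card_3_with_two:
  assumes "card A = 3" "a \<in> A" "b \<in> A" "a \<noteq> b"
  shows "\<exists>c. A = {a, b, c} \<and> c \<noteq> a \<and> c \<noteq> b"
  using assms by (auto simp: card_3_iff)

section \<open>Maximal dissociation sets under vertex deletion\<close>

text \<open>Only the adjacency relation is fixed. An induced subgraph is represented by its vertex
  set, so deleting vertices is set difference and the induction runs over sets.\<close>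

locale adjacency =
  fixes adj :: "'a \<Rightarrow> 'a \<Rightarrow> bool"
  assumes adj_sym: "adj u v \<Longrightarrow> adj v u"
    and adj_irrefl: "\<not> adj v v"
begin

definition nbrs :: "'a set \<Rightarrow> 'a \<Rightarrow> 'a set" where
  "nbrs V v = {u \<in> V. adj v u}"

definition closed_nbhd :: "'a set \<Rightarrow> 'a set" where
  "closed_nbhd A = A \<union> {u. \<exists>a\<in>A. adj a u}"

definition dissoc :: "'a set \<Rightarrow> bool" where
  "dissoc S \<longleftrightarrow> (\<forall>v\<in>S. \<forall>a\<in>S. \<forall>b\<in>S. adj v a \<longrightarrow> adj v b \<longrightarrow> a = b)"

text \<open>Maximality is tested by adding single vertices; this is the usual notion because
  \<open>dissoc\<close> passes to subsets.\<close>

definition mds :: "'a set \<Rightarrow> 'a set set" where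
  "mds V = {S. S \<subseteq> V \<and> dissoc S \<and> (\<forall>w\<in>V - S. \<not> dissoc (insert w S))}"

definition mds_with :: "'a set \<Rightarrow> 'a set \<Rightarrow> 'a set set" where
  "mds_with V R = {S \<in> mds V. R \<subseteq> S}"

definition iso_mds :: "'a set \<Rightarrow> 'a \<Rightarrow> 'a set set" where
  "iso_mds V v = {S \<in> mds V. v \<in> S \<and> nbrs S v = {}}"

text \<open>For a neighbour \<open>u\<close> of \<open>v\<close> these are the vertices of
  \<open>V\<close> that the closed neighbourhood of \<open>{v, u}\<close> has beyond that of
  \<open>v\<close>. Their number is the extra gain of the branch in which \<open>v\<close> and
  \<open>u\<close> form an edge.\<close>

definition priv :: "'a set \<Rightarrow> 'a \<Rightarrow> 'a \<Rightarrow> 'a set" where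
  "priv V v u = nbrs V u - insert v (nbrs V v)"

abbreviation num :: "'a set \<Rightarrow> real" where
  "num V \<equiv> real (card (mds V))"

text \<open>The induction hypothesis as a predicate. It speaks of proper subsets only and so passes
  to subsets, which permits branching again after a deletion.\<close>

definition subsets_bounded :: "'a set \<Rightarrow> bool" where
  "subsets_bounded V \<longleftrightarrow> finite V \<and> (\<forall>W. W \<subset> V \<longrightarrow> num W \<le> growth ^ card W)"

lemma nbrs_sym: "u \<in> nbrs V v \<Longrightarrow> v \<in> V \<Longrightarrow> v \<in> nbrs V u"
  by (auto simp: nbrs_def adj_sym)

lemma nbrs_in: "u \<in> nbrs V v \<Longrightarrow> u \<in> V"
  by (auto simp: nbrs_def)

lemma nbrs_irrefl: "v \<notin> nbrs V v"
  by (auto simp: nbrs_def adj_irrefl)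

lemma finite_nbrs: "finite V \<Longrightarrow> finite (nbrs V v)"
  by (simp add: nbrs_def)

lemma finite_priv: "finite V \<Longrightarrow> finite (priv V v u)"
  by (simp add: priv_def finite_nbrs)

lemma nbrs_Diff: "nbrs (V - A) v = nbrs V v - A"
  by (auto simp: nbrs_def)

lemma finite_mds: "finite V \<Longrightarrow> finite (mds V)"
  by (rule finite_subset[of _ "Pow V"]) (auto simp: mds_def)

lemma finite_mds_with: "finite V \<Longrightarrow> finite (mds_with V R)"
  by (simp add: mds_with_def finite_mds)

lemma mds_with_empty: "\<not> R \<subseteq> V \<Longrightarrow> mds_with V R = {}"
  by (auto simp: mds_with_def mds_def)

lemma dissoc_subset: "dissoc S \<Longrightarrow> T \<subseteq> S \<Longrightarrow> dissoc T"
  unfolding dissoc_def by blast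

text \<open>The only possible partner \<open>v\<close> of \<open>u\<close> has no neighbour in
  \<open>S\<close>, so adding \<open>u\<close> creates at most the edge between them. Taking
  \<open>u\<close> equal to \<open>v\<close> covers a vertex without neighbours in
  \<open>S\<close>.\<close>

lemma dissoc_insert_pendant:
  assumes "dissoc S" "nbrs S u \<subseteq> {v}" "nbrs S v = {}"
  shows "dissoc (insert u S)"
  unfolding dissoc_def
proof (intro ballI impI)
  fix x a b
  assume h: "x \<in> insert u S" "a \<in> insert u S" "b \<in> insert u S" "adj x a" "adj x b"
  have only: "s = v" if "s \<in> S" "adj u s" for s
    using that assms(2) by (auto simp: nbrs_def)
  have noadj: "\<not> adj v s" if "s \<in> S" for s
    using that assms(3) by (auto simp: nbrs_def)
  show "a = b"
  proof (cases "x = u")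
    case True
    then show ?thesis using h only adj_irrefl by blast
  next
    case False
    then show ?thesis using h only noadj adj_sym assms(1) unfolding dissoc_def by blast
  qed
qed

lemma dissoc_insert_isolated: "dissoc S \<Longrightarrow> nbrs S v = {} \<Longrightarrow> dissoc (insert v S)"
  by (rule dissoc_insert_pendant[of S v v]) auto

section \<open>Removing components and branching at a vertex\<close>

lemma mds_remove_component:
  assumes S: "S \<in> mds V" and A: "A \<subseteq> S" and sep: "\<And>a s. a \<in> A \<Longrightarrow> s \<in> S - A \<Longrightarrow> \<not> adj a s"
  shows "S - A \<in> mds (V - closed_nbhd A)"
proof -
  have SV: "S \<subseteq> V" and dS: "dissoc S" and mx: "\<And>w. w \<in> V - S \<Longrightarrow> \<not> dissoc (insert w S)"
    using S by (auto simp: mds_def)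
  have "S - A \<subseteq> V - closed_nbhd A"
    using SV sep by (auto simp: closed_nbhd_def)
  moreover have "dissoc (S - A)" using dS by (rule dissoc_subset) auto
  \<comment> \<open>A vertex outside N[A] does not interact with \<open>A\<close>: if it could be
    added to \<open>S - A\<close>, it could be added to \<open>S\<close>, against
    maximality.\<close>
  moreover have "\<not> dissoc (insert w (S - A))" if w: "w \<in> V - closed_nbhd A - (S - A)" for w
  proof
    assume d: "dissoc (insert w (S - A))"
    have wA: "w \<notin> A" "\<And>a. a \<in> A \<Longrightarrow> \<not> adj a w" "\<And>a. a \<in> A \<Longrightarrow> \<not> adj w a"
      using w adj_sym by (auto simp: closed_nbhd_def)
    have "dissoc (insert w S)"
      unfolding dissoc_def
    proof (intro ballI impI)
      fix x a b
      assume h: "x \<in> insert w S" "a \<in> insert w S" "b \<in> insert w S" "adj x a" "adj x b"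
      show "a = b"
      proof (cases "x \<in> A")
        case True
        then have "a \<in> S" "b \<in> S" "x \<in> S" using h wA A by auto
        then show ?thesis using dS h unfolding dissoc_def by blast
      next
        case False
        have "a \<notin> A" "b \<notin> A" using False h wA sep adj_sym by blast+
        then show ?thesis using False h d unfolding dissoc_def by blast
      qed
    qed
    moreover have "w \<in> V - S" using w wA by auto
    ultimately show False using mx by blast
  qed
  ultimately show ?thesis by (auto simp: mds_def)
qed

text \<open>Deleting \<open>A\<close> is injective on sets that all contain \<open>A\<close>. The
  vertices of \<open>R\<close> outside \<open>A\<close> stay prescribed, so a second prescribed
  vertex can be treated after the first.\<close>

lemma card_remove_component:
  assumes fin: "finite V" and F: "F \<subseteq> mds_with V (A \<union> R)"
    and sep: "\<And>S a s. S \<in> F \<Longrightarrow> a \<in> A \<Longrightarrow> s \<in> S - A \<Longrightarrow> \<not> adj a s"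
  shows "card F \<le> card (mds_with (V - closed_nbhd A) (R - A))"
proof (rule card_inj_on_le)
  show "inj_on (\<lambda>S. S - A) F"
    using F by (auto simp: inj_on_def mds_with_def)
  show "(\<lambda>S. S - A) ` F \<subseteq> mds_with (V - closed_nbhd A) (R - A)"
    using F sep by (auto simp: mds_with_def intro!: mds_remove_component)
  show "finite (mds_with (V - closed_nbhd A) (R - A))"
    using fin by (intro finite_mds_with) auto
qed

lemma card_iso_le:
  assumes "finite V" "\<And>S. S \<in> iso_mds V v \<Longrightarrow> R \<subseteq> S"
  shows "card (iso_mds V v) \<le> card (mds_with (V - closed_nbhd {v}) (R - {v}))"
  using assms(1)
proof (rule card_remove_component)
  show "iso_mds V v \<subseteq> mds_with V ({v} \<union> R)"
    using assms(2) by (auto simp: iso_mds_def mds_with_def)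
qed (auto simp: iso_mds_def nbrs_def)

lemma card_edge_le:
  assumes "finite V" "adj v u"
  shows "card (mds_with V ({v, u} \<union> R)) \<le> card (mds_with (V - closed_nbhd {v, u}) (R - {v, u}))"
  using assms(1)
proof (rule card_remove_component)
  fix S a s assume h: "S \<in> mds_with V ({v, u} \<union> R)" "a \<in> {v, u}" "s \<in> S - {v, u}"
  then have "dissoc S" "v \<in> S" "u \<in> S" "s \<in> S" by (auto simp: mds_with_def mds_def)
  then show "\<not> adj a s" using h assms(2) adj_sym[OF assms(2)] unfolding dissoc_def by blast
qed auto

text \<open>In a dissociation set \<open>v\<close> has either no neighbour or exactly one; the union
  runs over the possible partners.\<close>

lemma mds_with_vertex_cover:
  "mds_with V (insert v R) \<subseteq>
     {S \<in> iso_mds V v. R \<subseteq> S} \<union> (\<Union>u\<in>nbrs V v. mds_with V ({v, u} \<union> R))"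
  by (auto simp: mds_with_def iso_mds_def nbrs_def mds_def)

lemma card_mds_with_vertex:
  assumes fin: "finite V"
  shows "card (mds_with V (insert v R)) \<le> card {S \<in> iso_mds V v. R \<subseteq> S} +
     (\<Sum>u\<in>nbrs V v. card (mds_with (V - closed_nbhd {v, u}) (R - {v, u})))"
proof -
  have "card (mds_with V (insert v R)) \<le>
      card ({S \<in> iso_mds V v. R \<subseteq> S} \<union> (\<Union>u\<in>nbrs V v. mds_with V ({v, u} \<union> R)))"
    using fin by (intro card_mono mds_with_vertex_cover)
      (auto simp: iso_mds_def finite_mds finite_nbrs finite_mds_with)
  also have "\<dots> \<le> card {S \<in> iso_mds V v. R \<subseteq> S} + card (\<Union>u\<in>nbrs V v. mds_with V ({v, u} \<union> R))"
    by (rule card_Un_le)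
  also have "card (\<Union>u\<in>nbrs V v. mds_with V ({v, u} \<union> R)) \<le>
      (\<Sum>u\<in>nbrs V v. card (mds_with V ({v, u} \<union> R)))"
    using fin by (intro card_UN_le finite_nbrs)
  also have "\<dots> \<le> (\<Sum>u\<in>nbrs V v. card (mds_with (V - closed_nbhd {v, u}) (R - {v, u})))"
    using fin by (intro sum_mono card_edge_le) (auto simp: nbrs_def)
  finally show ?thesis by simp
qed

lemma mds_with_none: "mds_with V {} = mds V"
  by (simp add: mds_with_def)

lemma mds_avoid_subset: "{S \<in> mds V. v \<notin> S} \<subseteq> mds (V - {v})"
  by (auto simp: mds_def)

lemma card_branch:
  assumes fin: "finite V"
  shows "card (mds V) \<le> card (mds (V - {v})) + card (iso_mds V v) +
     (\<Sum>u\<in>nbrs V v. card (mds (V - closed_nbhd {v, u})))"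
proof -
  have "mds V \<subseteq> mds (V - {v}) \<union> mds_with V {v}"
    using mds_avoid_subset[of V v] by (auto simp: mds_with_def)
  then have "card (mds V) \<le> card (mds (V - {v}) \<union> mds_with V {v})"
    using fin by (intro card_mono) (auto simp: finite_mds finite_mds_with)
  also have "\<dots> \<le> card (mds (V - {v})) + card (mds_with V {v})" by (rule card_Un_le)
  also have "card (mds_with V {v}) \<le> card (iso_mds V v) +
     (\<Sum>u\<in>nbrs V v. card (mds (V - closed_nbhd {v, u})))"
    using card_mds_with_vertex[OF fin, of v "{}"] by (simp add: mds_with_none)
  finally show ?thesis by simp
qed

text \<open>If \<open>S\<close> missed these vertices, the only neighbour of \<open>u\<close> in
  \<open>S\<close> would be \<open>v\<close>, which is isolated in \<open>S\<close>; then
  \<open>u\<close> could be added.\<close>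

lemma iso_meets_priv:
  assumes S: "S \<in> iso_mds V v" and u: "u \<in> nbrs V v"
  shows "S \<inter> priv V v u \<noteq> {}"
proof
  assume e: "S \<inter> priv V v u = {}"
  have SV: "S \<subseteq> V" "dissoc S" "v \<in> S" "nbrs S v = {}"
    using S by (auto simp: iso_mds_def mds_def)
  have uS: "u \<notin> S" "u \<in> V" "adj v u" "adj u v" using SV u adj_sym by (auto simp: nbrs_def)
  have "nbrs S u \<subseteq> {v}" using e SV by (auto simp: priv_def nbrs_def)
  then have "dissoc (insert u S)" using SV by (intro dissoc_insert_pendant) auto
  moreover have "\<not> dissoc (insert u S)" using S uS by (auto simp: iso_mds_def mds_def)
  ultimately show False by blast
qed

lemma iso_empty: "u \<in> nbrs V v \<Longrightarrow> priv V v u = {} \<Longrightarrow> iso_mds V v = {}"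
  using iso_meets_priv by blast

lemma iso_forces: "u \<in> nbrs V v \<Longrightarrow> priv V v u = {w} \<Longrightarrow> S \<in> iso_mds V v \<Longrightarrow> w \<in> S"
  using iso_meets_priv[of S V v u] by auto

section \<open>Deletions measured against the induction hypothesis\<close>

lemma subsets_bounded_mono: "subsets_bounded V \<Longrightarrow> W \<subseteq> V \<Longrightarrow> subsets_bounded W"
  by (auto simp: subsets_bounded_def intro: finite_subset)

lemma growth_Diff_le:
  assumes "finite V" "k \<le> card (V \<inter> B)"
  shows "growth ^ card (V - B) \<le> shrink ^ k * growth ^ card V"
proof -
  have "card V = card (V \<inter> B) + card (V - B)"
    using assms(1) by (metis card_Int_Diff)
  then have "k + card (V - B) \<le> card V" using assms by simp
  then have "growth ^ (k + card (V - B)) \<le> growth ^ card V"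
    using growth_ge_1 by (intro power_increasing)
  then have "shrink ^ k * growth ^ (k + card (V - B)) \<le> shrink ^ k * growth ^ card V"
    using shrink_pos by (intro mult_left_mono) auto
  moreover have "shrink ^ k * growth ^ (k + card (V - B)) = growth ^ card (V - B)"
    using shrink_growth[of k] by (simp add: power_add mult.assoc[symmetric])
  ultimately show ?thesis by simp
qed

lemma num_Diff_le:
  assumes "subsets_bounded V" "0 < k" "k \<le> card (V \<inter> B)"
  shows "num (V - B) \<le> shrink ^ k * growth ^ card V"
proof -
  \<comment> \<open>Positivity of \<open>k\<close> makes \<open>V - B\<close> a proper subset, to
    which the induction hypothesis applies.\<close>
  have "V \<inter> B \<noteq> {}" using assms by auto
  then have "num (V - B) \<le> growth ^ card (V - B)"
    using assms(1) by (auto simp: subsets_bounded_def)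
  also have "\<dots> \<le> shrink ^ k * growth ^ card V"
    using assms by (intro growth_Diff_le) (auto simp: subsets_bounded_def)
  finally show ?thesis .
qed

lemma Int_closed_nbhd1: "v \<in> V \<Longrightarrow> V \<inter> closed_nbhd {v} = insert v (nbrs V v)"
  by (auto simp: closed_nbhd_def nbrs_def)

lemma card_closed_nbhd1:
  "finite V \<Longrightarrow> v \<in> V \<Longrightarrow> card (V \<inter> closed_nbhd {v}) = card (nbrs V v) + 1"
  by (simp add: Int_closed_nbhd1 finite_nbrs nbrs_irrefl)

lemma Int_closed_nbhd2:
  "v \<in> V \<Longrightarrow> u \<in> nbrs V v \<Longrightarrow>
    V \<inter> closed_nbhd {v, u} = insert v (nbrs V v) \<union> priv V v u"
  by (auto simp: closed_nbhd_def nbrs_def priv_def)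

lemma card_closed_nbhd2:
  assumes "finite V" "v \<in> V" "u \<in> nbrs V v"
  shows "card (V \<inter> closed_nbhd {v, u}) = card (nbrs V v) + 1 + card (priv V v u)"
proof -
  have "card (insert v (nbrs V v) \<union> priv V v u) = card (insert v (nbrs V v)) + card (priv V v u)"
    using assms by (intro card_Un_disjoint) (auto simp: finite_nbrs finite_priv priv_def)
  then show ?thesis
    using assms by (simp add: Int_closed_nbhd2 finite_nbrs nbrs_irrefl)
qed

lemma num_edge_le:
  assumes "subsets_bounded V" "v \<in> V" "u \<in> nbrs V v"
  shows "num (V - closed_nbhd {v, u}) \<le>
    shrink ^ (card (nbrs V v) + 1 + card (priv V v u)) * growth ^ card V"
  using assms by (intro num_Diff_le) (auto simp: card_closed_nbhd2 subsets_bounded_def)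

text \<open>The branch with edge \<open>{v, u}\<close> deletes N[v] and the private part of
  \<open>u\<close>. The common factor for N[v] is taken out, so each degree case only has to
  estimate a sum over neighbours.\<close>

lemma num_branch:
  assumes b: "subsets_bounded V" and v: "v \<in> V"
  shows "num V \<le> num (V - {v}) + real (card (iso_mds V v)) +
    shrink ^ (card (nbrs V v) + 1) * (\<Sum>u\<in>nbrs V v. shrink ^ card (priv V v u)) * growth ^ card V"
proof -
  have fin: "finite V" using b by (simp add: subsets_bounded_def)
  have "num V \<le> real (card (mds (V - {v})) + card (iso_mds V v) +
     (\<Sum>u\<in>nbrs V v. card (mds (V - closed_nbhd {v, u}))))"
    using card_branch[OF fin, of v] by (simp only: of_nat_le_iff)
  also have "\<dots> = num (V - {v}) + real (card (iso_mds V v)) + (\<Sum>u\<in>nbrs V v. num (V - closed_nbhd {v, u}))"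
    by simp
  also have "(\<Sum>u\<in>nbrs V v. num (V - closed_nbhd {v, u})) \<le>
     (\<Sum>u\<in>nbrs V v. shrink ^ (card (nbrs V v) + 1 + card (priv V v u)) * growth ^ card V)"
    using b v by (intro sum_mono num_edge_le)
  also have "\<dots> = shrink ^ (card (nbrs V v) + 1) *
      (\<Sum>u\<in>nbrs V v. shrink ^ card (priv V v u)) * growth ^ card V"
    by (simp add: power_add sum_distrib_left sum_distrib_right mult_ac)
  finally show ?thesis by simp
qed

lemma num_remove_vertex:
  assumes "subsets_bounded V" "v \<in> V"
  shows "num (V - {v}) \<le> shrink * growth ^ card V"
  using num_Diff_le[OF assms(1), of 1 "{v}"] assms(2) by simp

lemma iso_le:
  assumes "subsets_bounded V" "v \<in> V"
  shows "real (card (iso_mds V v)) \<le> shrink ^ (card (nbrs V v) + 1) * growth ^ card V"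
proof -
  have fin: "finite V" using assms by (simp add: subsets_bounded_def)
  have "real (card (iso_mds V v)) \<le> num (V - closed_nbhd {v})"
    using card_iso_le[OF fin, of v "{}"] by (simp add: mds_with_none)
  also have "\<dots> \<le> shrink ^ (card (nbrs V v) + 1) * growth ^ card V"
    using assms fin by (intro num_Diff_le) (auto simp: card_closed_nbhd1)
  finally show ?thesis .
qed

section \<open>Maximal sets with prescribed vertices\<close>

lemma one_forced:
  assumes b: "subsets_bounded V"
  shows "real (card (mds_with V {w})) \<le> 2 * shrink ^ 2 * growth ^ card V"
proof (cases "w \<in> V")
  case False
  then show ?thesis using growth_pos shrink_pos by (simp add: mds_with_empty)
next
  case w: True
  have fin: "finite V" using b by (simp add: subsets_bounded_def)
  let ?d = "card (nbrs V w)"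
  have "real (card (mds_with V {w})) \<le> real (card (iso_mds V w) +
     (\<Sum>u\<in>nbrs V w. card (mds (V - closed_nbhd {w, u}))))"
    using card_mds_with_vertex[OF fin, of w "{}"] by (simp only: of_nat_le_iff) (simp add: mds_with_none)
  also have "\<dots> = real (card (iso_mds V w)) + (\<Sum>u\<in>nbrs V w. num (V - closed_nbhd {w, u}))"
    by simp
  also have "(\<Sum>u\<in>nbrs V w. num (V - closed_nbhd {w, u})) \<le>
     (\<Sum>u\<in>nbrs V w. shrink ^ (?d + 1) * growth ^ card V)"
    using b w fin by (intro sum_mono num_Diff_le) (auto simp: card_closed_nbhd2)
  also have "\<dots> = real ?d * shrink ^ (?d + 1) * growth ^ card V" by simp
  \<comment> \<open>One branch leaves \<open>w\<close> isolated, one exists for each of the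
    \<open>?d\<close> neighbours, and each deletes at least \<open>?d + 1\<close> vertices.\<close>
  finally have "real (card (mds_with V {w})) \<le> (real (?d + 1) * shrink ^ (?d + 1)) * growth ^ card V"
    using iso_le[OF b w] by (simp add: algebra_simps)
  also have "\<dots> \<le> (2 * shrink ^ 2) * growth ^ card V"
    using growth_pos by (intro mult_right_mono linear_shrink_le) auto
  finally show ?thesis .
qed

lemma one_forced_Diff:
  assumes b: "subsets_bounded V" and k: "k \<le> card (V \<inter> B)"
  shows "real (card (mds_with (V - B) {w})) \<le> 2 * shrink ^ 2 * (shrink ^ k * growth ^ card V)"
proof -
  have "real (card (mds_with (V - B) {w})) \<le> 2 * shrink ^ 2 * growth ^ card (V - B)"
    by (rule one_forced[OF subsets_bounded_mono[OF b]]) auto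
  also have "\<dots> \<le> 2 * shrink ^ 2 * (shrink ^ k * growth ^ card V)"
    using b k shrink_pos by (intro mult_left_mono growth_Diff_le) (auto simp: subsets_bounded_def)
  finally show ?thesis .
qed

text \<open>For nonadjacent \<open>w\<close> and \<open>z\<close> branching at \<open>w\<close>
  keeps \<open>z\<close> prescribed, so the one-vertex bound applies again and the factors 2 q^2
  multiply. Adjacent vertices form a component of the set, and the single resulting branch gains q^2
  <= 4 q^4.\<close>

lemma two_forced:
  assumes b: "subsets_bounded V" and ne: "w \<noteq> z"
  shows "real (card (mds_with V {w, z})) \<le> 4 * shrink ^ 4 * growth ^ card V"
proof (cases "w \<in> V \<and> z \<in> V")
  case False
  then show ?thesis using growth_pos shrink_pos by (simp add: mds_with_empty)
next
  case wz: True
  have fin: "finite V" using b by (simp add: subsets_bounded_def)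
  show ?thesis
  proof (cases "adj w z")
    case True
    have "real (card (mds_with V {w, z})) \<le> num (V - closed_nbhd {w, z})"
      using card_edge_le[OF fin True, of "{}"] by (simp add: mds_with_none)
    also have "\<dots> \<le> shrink ^ 2 * growth ^ card V"
    proof (rule num_Diff_le[OF b])
      have "card {w, z} \<le> card (V \<inter> closed_nbhd {w, z})"
        using fin wz by (intro card_mono) (auto simp: closed_nbhd_def)
      then show "2 \<le> card (V \<inter> closed_nbhd {w, z})" using ne by simp
    qed simp
    also have "\<dots> \<le> 4 * shrink ^ 4 * growth ^ card V"
    proof -
      have "shrink ^ 2 * 1 \<le> shrink ^ 2 * (4 * shrink ^ 2)"
        using power_mono[OF shrink_lower, of 2] shrink_pos
        by (intro mult_left_mono) (auto simp: power2_eq_square)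
      then have "shrink ^ 2 \<le> 4 * shrink ^ 4" by (simp add: power_numeral_reduce)
      then show ?thesis using growth_pos by (intro mult_right_mono) auto
    qed
    finally show ?thesis .
  next
    case False
    let ?d = "card (nbrs V w)"
    have w: "w \<in> V" using wz by simp
    have "real (card (mds_with V {w, z})) \<le> real (card {S \<in> iso_mds V w. {z} \<subseteq> S} +
       (\<Sum>u\<in>nbrs V w. card (mds_with (V - closed_nbhd {w, u}) ({z} - {w, u}))))"
      using card_mds_with_vertex[OF fin, of w "{z}"] by (simp only: of_nat_le_iff)
    also have "\<dots> = real (card {S \<in> iso_mds V w. {z} \<subseteq> S}) +
       (\<Sum>u\<in>nbrs V w. real (card (mds_with (V - closed_nbhd {w, u}) ({z} - {w, u}))))"
      by simp
    also have "real (card {S \<in> iso_mds V w. {z} \<subseteq> S}) \<le>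
       real (card (mds_with (V - closed_nbhd {w}) {z}))"
    proof -
      have "card {S \<in> iso_mds V w. {z} \<subseteq> S} \<le> card (mds_with (V - closed_nbhd {w}) ({z} - {w}))"
        using fin by (rule card_remove_component) (auto simp: iso_mds_def nbrs_def mds_with_def)
      moreover have "{z} - {w} = {z}" using ne by auto
      ultimately show ?thesis by simp
    qed
    also have "\<dots> \<le> 2 * shrink ^ 2 * (shrink ^ (?d + 1) * growth ^ card V)"
      using b w fin by (intro one_forced_Diff) (auto simp: card_closed_nbhd1)
    also have "(\<Sum>u\<in>nbrs V w. real (card (mds_with (V - closed_nbhd {w, u}) ({z} - {w, u})))) \<le>
       (\<Sum>u\<in>nbrs V w. 2 * shrink ^ 2 * (shrink ^ (?d + 1) * growth ^ card V))"
    proof (rule sum_mono)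
      fix u assume u: "u \<in> nbrs V w"
      \<comment> \<open>No branch discharges \<open>z\<close>, as it is neither \<open>w\<close> nor
        a neighbour of \<open>w\<close>. If \<open>z\<close> lies in the deleted neighbourhood, no
        set remains and the bound is trivial.\<close>
      then have "{z} - {w, u} = {z}" using ne False by (auto simp: nbrs_def)
      then show "real (card (mds_with (V - closed_nbhd {w, u}) ({z} - {w, u}))) \<le>
          2 * shrink ^ 2 * (shrink ^ (?d + 1) * growth ^ card V)"
        using b w fin u one_forced_Diff[of V "?d + 1" "closed_nbhd {w, u}" z]
        by (simp add: card_closed_nbhd2)
    qed
    also have "\<dots> = real ?d * (2 * shrink ^ 2 * (shrink ^ (?d + 1) * growth ^ card V))" by simp
    finally have "real (card (mds_with V {w, z})) \<le>
        (2 * shrink ^ 2) * (real (?d + 1) * shrink ^ (?d + 1)) * growth ^ card V"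
      by (simp add: algebra_simps)
    also have "\<dots> \<le> (2 * shrink ^ 2) * (2 * shrink ^ 2) * growth ^ card V"
      using growth_pos shrink_pos by (intro mult_right_mono mult_left_mono linear_shrink_le) auto
    finally show ?thesis by (simp add: power_numeral_reduce)
  qed
qed

lemma iso_one_forced:
  assumes b: "subsets_bounded V" and v: "v \<in> V" and u: "u \<in> nbrs V v" "priv V v u = {w}"
  shows "real (card (iso_mds V v)) \<le>
    2 * shrink ^ 2 * (shrink ^ (card (nbrs V v) + 1) * growth ^ card V)"
proof -
  have fin: "finite V" using b by (simp add: subsets_bounded_def)
  have "{w} - {v} = {w}" using u(2) by (auto simp: priv_def)
  then have "card (iso_mds V v) \<le> card (mds_with (V - closed_nbhd {v}) {w})"
    using card_iso_le[OF fin, of v "{w}"] iso_forces[OF u] by auto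
  moreover have "real (card (mds_with (V - closed_nbhd {v}) {w})) \<le>
      2 * shrink ^ 2 * (shrink ^ (card (nbrs V v) + 1) * growth ^ card V)"
    using b v fin by (intro one_forced_Diff) (auto simp: card_closed_nbhd1)
  ultimately show ?thesis by linarith
qed

lemma iso_two_forced:
  assumes b: "subsets_bounded V" and v: "v \<in> V"
    and u: "u \<in> nbrs V v" "priv V v u = {w}" and u': "u' \<in> nbrs V v" "priv V v u' = {w'}"
    and ne: "w \<noteq> w'"
  shows "real (card (iso_mds V v)) \<le>
    4 * shrink ^ 4 * (shrink ^ (card (nbrs V v) + 1) * growth ^ card V)"
proof -
  have fin: "finite V" using b by (simp add: subsets_bounded_def)
  have "{w, w'} - {v} = {w, w'}" using u(2) u'(2) by (auto simp: priv_def)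
  then have "card (iso_mds V v) \<le> card (mds_with (V - closed_nbhd {v}) {w, w'})"
    using card_iso_le[OF fin, of v "{w, w'}"] iso_forces[OF u] iso_forces[OF u'] by auto
  moreover have "real (card (mds_with (V - closed_nbhd {v}) {w, w'})) \<le>
      4 * shrink ^ 4 * growth ^ card (V - closed_nbhd {v})"
    by (rule two_forced[OF subsets_bounded_mono[OF b] ne]) auto
  moreover have "\<dots> \<le> 4 * shrink ^ 4 * (shrink ^ (card (nbrs V v) + 1) * growth ^ card V)"
    using v fin shrink_pos by (intro mult_left_mono growth_Diff_le) (auto simp: card_closed_nbhd1)
  ultimately show ?thesis by linarith
qed

subsection \<open>Leaves and small components\<close>

text \<open>By maximality a vertex without neighbours lies in every maximal set, so only the branch
  that removes it is left.\<close>

lemma num_isolated: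
  assumes b: "subsets_bounded V" and v: "v \<in> V" "nbrs V v = {}"
  shows "num V \<le> shrink * growth ^ card V"
proof -
  have fin: "finite V" using b by (simp add: subsets_bounded_def)
  have "mds V \<subseteq> iso_mds V v"
  proof
    fix S assume S: "S \<in> mds V"
    then have SV: "S \<subseteq> V" "dissoc S" by (auto simp: mds_def)
    then have n: "nbrs S v = {}" using v by (auto simp: nbrs_def)
    then have "v \<in> S" using S v dissoc_insert_isolated[OF SV(2) n] by (auto simp: mds_def)
    then show "S \<in> iso_mds V v" using S n by (simp add: iso_mds_def)
  qed
  then have "card (mds V) \<le> card (iso_mds V v)"
    using fin by (intro card_mono) (auto simp: iso_mds_def finite_mds)
  then show ?thesis using iso_le[OF b v(1)] v by simp
qed

text \<open>If \<open>l\<close> is outside \<open>S\<close>, then \<open>a\<close> is in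
  \<open>S\<close> and already has a partner, as otherwise \<open>l\<close> could be added. If
  \<open>l\<close> is in \<open>S\<close>, it is isolated or matched with \<open>a\<close>. Hence
  \<open>S\<close> has \<open>l\<close> isolated or contains an edge at \<open>a\<close>, and there
  is no branch that merely discards a vertex.\<close>

lemma card_leaf:
  assumes fin: "finite V" and l: "l \<in> V" "nbrs V l = {a}"
  shows "card (mds V) \<le> card (iso_mds V l) +
    (\<Sum>c\<in>nbrs V a. card (mds (V - closed_nbhd {a, c})))"
proof -
  have la: "l \<in> nbrs V a" using l nbrs_sym[of a V l] nbrs_in[of a V l]
    by (auto simp: nbrs_def adj_sym)
  have "mds V \<subseteq> iso_mds V l \<union> (\<Union>c\<in>nbrs V a. mds_with V ({a, c} \<union> {}))"
  proof
    fix S assume S: "S \<in> mds V"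
    then have SV: "S \<subseteq> V" "dissoc S" by (auto simp: mds_def)
    have nl: "nbrs S l \<subseteq> {a}" using l SV by (auto simp: nbrs_def)
    show "S \<in> iso_mds V l \<union> (\<Union>c\<in>nbrs V a. mds_with V ({a, c} \<union> {}))"
    proof (cases "l \<in> S")
      case True
      show ?thesis
      proof (cases "a \<in> S")
        case True
        then show ?thesis using \<open>l \<in> S\<close> la S by (auto simp: mds_with_def)
      next
        case False
        then have "nbrs S l = {}" using nl by (auto simp: nbrs_def)
        then show ?thesis using \<open>l \<in> S\<close> S by (auto simp: iso_mds_def)
      qed
    next
      case False
      then have nd: "\<not> dissoc (insert l S)" using S l by (auto simp: mds_def)
      have "a \<in> S"
      proof (rule ccontr)
        assume "a \<notin> S"
        then have "nbrs S l = {}" using nl by (auto simp: nbrs_def)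
        then show False using nd dissoc_insert_isolated[OF SV(2)] by blast
      qed
      moreover have "nbrs S a \<noteq> {}" using nd dissoc_insert_pendant[OF SV(2) nl] by blast
      ultimately show ?thesis using S SV by (auto simp: mds_with_def nbrs_def)
    qed
  qed
  then have "card (mds V) \<le> card (iso_mds V l \<union> (\<Union>c\<in>nbrs V a. mds_with V ({a, c} \<union> {})))"
    using fin by (intro card_mono) (auto simp: iso_mds_def finite_mds finite_nbrs finite_mds_with)
  also have "\<dots> \<le> card (iso_mds V l) + card (\<Union>c\<in>nbrs V a. mds_with V ({a, c} \<union> {}))"
    by (rule card_Un_le)
  also have "card (\<Union>c\<in>nbrs V a. mds_with V ({a, c} \<union> {})) \<le>
      (\<Sum>c\<in>nbrs V a. card (mds_with V ({a, c} \<union> {})))"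
    using fin by (intro card_UN_le finite_nbrs)
  also have "\<dots> \<le> (\<Sum>c\<in>nbrs V a. card (mds_with (V - closed_nbhd {a, c}) ({} - {a, c})))"
    using fin by (intro sum_mono card_edge_le) (auto simp: nbrs_def)
  finally show ?thesis by (simp add: mds_with_none)
qed

text \<open>The branch with \<open>l\<close> isolated deletes \<open>l\<close> and \<open>a\<close>.
  Each of the d edges at \<open>a\<close> deletes at least d + 1 vertices, and d q^d is at most 2
  q^2.\<close>

lemma num_leaf:
  assumes b: "subsets_bounded V" and l: "l \<in> V" "nbrs V l = {a}"
  shows "num V \<le> (shrink ^ 2 + 2 * shrink ^ 3) * growth ^ card V"
proof -
  have fin: "finite V" using b by (simp add: subsets_bounded_def)
  let ?d = "card (nbrs V a)"
  have a: "a \<in> V" "l \<in> nbrs V a" using l adj_sym by (auto simp: nbrs_def)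
  then have d: "1 \<le> ?d" using finite_nbrs[OF fin, of a] by (auto simp: Suc_le_eq card_gt_0_iff)
  have "num V \<le> real (card (iso_mds V l) + (\<Sum>c\<in>nbrs V a. card (mds (V - closed_nbhd {a, c}))))"
    using card_leaf[OF fin l] by (simp only: of_nat_le_iff)
  also have "\<dots> = real (card (iso_mds V l)) + (\<Sum>c\<in>nbrs V a. num (V - closed_nbhd {a, c}))"
    by simp
  also have "real (card (iso_mds V l)) \<le> shrink ^ 2 * growth ^ card V"
    using iso_le[OF b l(1)] l(2) by (simp add: numeral_2_eq_2)
  also have "(\<Sum>c\<in>nbrs V a. num (V - closed_nbhd {a, c})) \<le>
      (\<Sum>c\<in>nbrs V a. shrink ^ (?d + 1) * growth ^ card V)"
    using b a fin by (intro sum_mono num_Diff_le) (auto simp: card_closed_nbhd2)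
  also have "\<dots> = shrink * (real ?d * shrink ^ ?d) * growth ^ card V" by simp
  also have "\<dots> \<le> shrink * (2 * shrink ^ 2) * growth ^ card V"
    using d growth_pos shrink_pos by (intro mult_right_mono mult_left_mono linear_shrink_le) auto
  finally show ?thesis by (simp add: algebra_simps power_numeral_reduce)
qed

text \<open>Deleting \<open>v\<close> leaves \<open>u\<close> with at most one neighbour, so the
  leaf factor applies to the rest on top of the factor q for \<open>v\<close>.\<close>

lemma num_remove_near_low_degree:
  assumes b: "subsets_bounded V" and v: "v \<in> V" "u \<in> nbrs V v" "card (nbrs V u) \<le> 2"
  shows "num (V - {v}) \<le> (shrink ^ 3 + 2 * shrink ^ 4) * growth ^ card V"
proof -
  have fin: "finite V" using b by (simp add: subsets_bounded_def)
  have b': "subsets_bounded (V - {v})" by (rule subsets_bounded_mono[OF b]) auto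
  have u: "u \<in> V - {v}" using v nbrs_irrefl by (auto simp: nbrs_def adj_irrefl)
  have vu: "v \<in> nbrs V u" using v nbrs_sym by blast
  have "card (nbrs (V - {v}) u) \<le> 1"
    using v(3) vu finite_nbrs[OF fin, of u] by (simp add: nbrs_Diff)
  then consider "nbrs (V - {v}) u = {}" | a where "nbrs (V - {v}) u = {a}"
    using finite_nbrs[of "V - {v}" u] fin by (auto simp: le_Suc_eq card_1_singleton_iff)
  then have "num (V - {v}) \<le> (shrink ^ 2 + 2 * shrink ^ 3) * growth ^ card (V - {v})"
  proof cases
    case 1
    have "num (V - {v}) \<le> shrink * growth ^ card (V - {v})" by (rule num_isolated[OF b' u 1])
    also have "\<dots> \<le> (shrink ^ 2 + 2 * shrink ^ 3) * growth ^ card (V - {v})"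
      using growth_pos by (intro mult_right_mono shrink_le_leaf_factor) auto
    finally show ?thesis .
  next
    case 2
    then show ?thesis by (rule num_leaf[OF b' u])
  qed
  also have "\<dots> \<le> (shrink ^ 2 + 2 * shrink ^ 3) * (shrink ^ 1 * growth ^ card V)"
    using fin v shrink_pos by (intro mult_left_mono growth_Diff_le) auto
  finally show ?thesis by (simp add: algebra_simps power_numeral_reduce)
qed

section \<open>Vertex sets without outgoing edges\<close>

lemma mds_Int_closed:
  assumes C: "C \<subseteq> V" "\<And>a. a \<in> C \<Longrightarrow> nbrs V a \<subseteq> C" and S: "S \<in> mds V"
  shows "S \<inter> C \<in> mds C"
proof -
  have SV: "S \<subseteq> V" "dissoc S" using S by (auto simp: mds_def)
  have "\<not> dissoc (insert w (S \<inter> C))" if w: "w \<in> C - S \<inter> C" for w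
  proof
    assume d: "dissoc (insert w (S \<inter> C))"
    \<comment> \<open>No edge inside \<open>V\<close> crosses the boundary of \<open>C\<close>, so
      adding \<open>w\<close> can create a conflict only within \<open>C\<close>.\<close>
    have cl: "x \<in> C \<longleftrightarrow> y \<in> C" if "adj x y" "x \<in> V" "y \<in> V" for x y
      using C that adj_sym[OF that(1)] unfolding nbrs_def by blast
    have "dissoc (insert w S)"
      unfolding dissoc_def
    proof (intro ballI impI)
      fix x a b
      assume h: "x \<in> insert w S" "a \<in> insert w S" "b \<in> insert w S" "adj x a" "adj x b"
      have V: "x \<in> V" "a \<in> V" "b \<in> V" using h SV w C by auto
      show "a = b"
      proof (cases "x \<in> C")
        case True
        then have "a \<in> C" "b \<in> C" using cl h V by blast+
        then show ?thesis using True h d unfolding dissoc_def by blast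
      next
        case False
        then have "a \<notin> C" "b \<notin> C" using cl h V by blast+
        then show ?thesis using False h w SV(2) unfolding dissoc_def by blast
      qed
    qed
    moreover have "w \<in> V - S" using w C by auto
    ultimately show False using S by (auto simp: mds_def)
  qed
  moreover have "dissoc (S \<inter> C)" using SV(2) by (rule dissoc_subset) auto
  ultimately show ?thesis by (auto simp: mds_def)
qed

text \<open>A maximal set is determined by its traces on \<open>C\<close> and on
  \<open>V - C\<close>, and both traces are maximal.\<close>

lemma card_mds_closed:
  assumes fin: "finite V" and C: "C \<subseteq> V" "\<And>a. a \<in> C \<Longrightarrow> nbrs V a \<subseteq> C"
  shows "card (mds V) \<le> card (mds C) * card (mds (V - C))"
proof -
  have C': "nbrs V a \<subseteq> V - C" if "a \<in> V - C" for a
    using that C(2) nbrs_sym[of _ V a] by (auto simp: nbrs_def)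
  have "card (mds V) \<le> card (mds C \<times> mds (V - C))"
  proof (rule card_inj_on_le)
    show "inj_on (\<lambda>S. (S \<inter> C, S \<inter> (V - C))) (mds V)"
      using C(1) by (auto simp: inj_on_def mds_def)
    show "(\<lambda>S. (S \<inter> C, S \<inter> (V - C))) ` mds V \<subseteq> mds C \<times> mds (V - C)"
    proof clarify
      fix S assume "S \<in> mds V"
      then show "S \<inter> C \<in> mds C \<and> S \<inter> (V - C) \<in> mds (V - C)"
        using mds_Int_closed[OF C] mds_Int_closed[OF _ C'] by blast
    qed
    show "finite (mds C \<times> mds (V - C))"
      using fin finite_subset[OF C(1)] by (intro finite_cartesian_product finite_mds) auto
  qed
  then show ?thesis by (simp add: card_cartesian_product)
qed

text \<open>Counts multiply over components, so it suffices to bound one of them. The case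
  \<open>C = V\<close> is allowed, hence the separate assumption on \<open>num C\<close>.\<close>

lemma num_component:
  assumes b: "subsets_bounded V" and C: "C \<subseteq> V" "\<And>a. a \<in> C \<Longrightarrow> nbrs V a \<subseteq> C"
    and ne: "C \<noteq> {}" and le: "num C \<le> growth ^ card C"
  shows "num V \<le> growth ^ card V"
proof -
  have fin: "finite V" using b by (simp add: subsets_bounded_def)
  have "num V \<le> num C * num (V - C)"
    using card_mds_closed[OF fin C] by (simp only: of_nat_mult[symmetric] of_nat_le_iff)
  also have "\<dots> \<le> growth ^ card C * growth ^ card (V - C)"
  proof (rule mult_mono[OF le])
    have "V - C \<subset> V" using C(1) ne by blast
    then show "num (V - C) \<le> growth ^ card (V - C)" using b by (simp add: subsets_bounded_def)
  qed (use growth_pos in auto)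
  also have "\<dots> = growth ^ card V"
    using card_Int_Diff[OF fin, of C] C(1) by (simp add: power_add Int_absorb1)
  finally show ?thesis .
qed

lemma card_mds_empty: "card (mds {}) = 1"
proof -
  have "mds {} = {{}}" by (auto simp: mds_def dissoc_def)
  then show ?thesis by simp
qed

lemma num_universal:
  assumes b: "subsets_bounded V" and v: "v \<in> V" "nbrs V v = V - {v}" and c: "card V \<in> {4, 5}"
  shows "num V \<le> growth ^ card V"
proof -
  have fin: "finite V" using b by (simp add: subsets_bounded_def)
  have d: "card (nbrs V v) = card V - 1" using v fin by simp
  then obtain u where u: "u \<in> nbrs V v"
    using c by (cases "nbrs V v = {}") auto
  have "priv V v u = {}" using v by (auto simp: priv_def nbrs_def)
  then have iso: "iso_mds V v = {}" using iso_empty u by blast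
  have "(\<Sum>u\<in>nbrs V v. card (mds (V - closed_nbhd {v, u}))) = (\<Sum>u\<in>nbrs V v. 1)"
  proof (rule sum.cong)
    fix u assume "u \<in> nbrs V v"
    have "V - closed_nbhd {v, u} = {}" using v by (auto simp: closed_nbhd_def nbrs_def)
    then show "card (mds (V - closed_nbhd {v, u})) = 1" by (simp only: card_mds_empty)
  qed simp
  then have M: "card (mds V) \<le> card (mds (V - {v})) + (card V - 1)"
    using card_branch[OF fin, of v] iso d by simp
  have "V - {v} \<subset> V" using v by blast
  then have "num (V - {v}) \<le> growth ^ card (V - {v})" using b by (simp add: subsets_bounded_def)
  then have r: "num (V - {v}) \<le> growth ^ (card V - 1)" using v fin by simp
  from c consider "card V = 4" | "card V = 5" by auto
  then show ?thesis
  proof cases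
    case 1
    then have "num (V - {v}) < 4" using r growth_powers(1) by simp
    then have "card (mds V) \<le> 6" using M 1 by simp
    then show ?thesis using growth_powers(2) 1 by simp
  next
    case 2
    then have "num (V - {v}) < 7" using r growth_powers(3) by simp
    then have "card (mds V) \<le> 10" using M 2 by simp
    then show ?thesis using growth_power_5 2 by simp
  qed
qed

text \<open>Empty private parts mean that no edge leaves N[v], so N[v] is a component in which
  \<open>v\<close> is adjacent to all other vertices.\<close>

lemma num_universal_component:
  assumes b: "subsets_bounded V" and v: "v \<in> V" "card (nbrs V v) \<in> {3, 4}"
    and p: "\<And>u. u \<in> nbrs V v \<Longrightarrow> priv V v u = {}"
  shows "num V \<le> growth ^ card V"
proof (rule num_component[OF b])
  let ?C = "insert v (nbrs V v)"
  have fin: "finite V" using b by (simp add: subsets_bounded_def)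
  show CV: "?C \<subseteq> V" using v by (auto simp: nbrs_def)
  show "nbrs V a \<subseteq> ?C" if "a \<in> ?C" for a
    using that p[of a] by (auto simp: priv_def)
  show "num ?C \<le> growth ^ card ?C"
  proof (rule num_universal)
    show "subsets_bounded ?C" using b CV by (rule subsets_bounded_mono)
    show "nbrs ?C v = ?C - {v}" using nbrs_irrefl by (auto simp: nbrs_def adj_irrefl)
    show "card ?C \<in> {4, 5}" using v finite_nbrs[OF fin] nbrs_irrefl by auto
  qed simp
qed simp

text \<open>Rounding to integers: at most 3 sets avoid \<open>v\<close>, at most 1 has
  \<open>v\<close> isolated, and at most 2 have \<open>v\<close> on an edge, together 6 <=
  x^4.\<close>

lemma num_square:
  assumes b: "subsets_bounded V" and V: "V = {v, u, w, z}" "card V = 4"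
    and n: "nbrs V v = {u, w}" "z \<in> nbrs V u" "z \<in> nbrs V w"
  shows "num V \<le> growth ^ card V"
proof -
  have fin: "finite V" using V by simp
  have uw: "u \<noteq> w"
  proof
    assume "u = w"
    then have "card V \<le> 3" using V(1) by (simp add: card_insert_if)
    then show False using V(2) by simp
  qed
  have "V - closed_nbhd {v, x} = {}" if "x \<in> nbrs V v" for x
  proof -
    have "{u, w} \<subseteq> nbrs V v" "x = u \<or> x = w" using n that by auto
    then show ?thesis using V n by (auto simp: closed_nbhd_def nbrs_def)
  qed
  then have "(\<Sum>x\<in>nbrs V v. card (mds (V - closed_nbhd {v, x}))) = (\<Sum>x\<in>nbrs V v. 1)"
    by (intro sum.cong) (simp_all only: card_mds_empty)
  then have s: "(\<Sum>x\<in>nbrs V v. card (mds (V - closed_nbhd {v, x}))) = 2"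
    using n uw by simp
  have v: "v \<in> V" using V by simp
  have "V - {v} \<subset> V" using v by blast
  then have "num (V - {v}) \<le> growth ^ card (V - {v})" using b by (simp add: subsets_bounded_def)
  then have "num (V - {v}) \<le> growth ^ 3" using v fin V(2) by simp
  then have r: "num (V - {v}) < 4" using growth_powers(1) by simp
  have "real (card (iso_mds V v)) \<le> shrink ^ 3 * growth ^ 4"
    using iso_le[OF b v] n uw V(2) by (simp add: numeral_3_eq_3)
  also have "\<dots> = growth" using shrink_growth[of 3] by (simp add: power_numeral_reduce)
  finally have i: "real (card (iso_mds V v)) < 2" using growth_le by simp
  have "card (mds V) \<le> 6" using card_branch[OF fin, of v] r i s by simp
  then show ?thesis using growth_powers(2) V(2) by simp
qed

subsection \<open>Branching by vertex degree\<close>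

text \<open>Reduces each degree case to one numerical inequality: \<open>r\<close> is the factor for
  deleting \<open>v\<close>, \<open>i\<close> the one for sets with \<open>v\<close> isolated, and
  \<open>s\<close> bounds the sum over the edges at \<open>v\<close>.\<close>

lemma num_branch_le:
  assumes "subsets_bounded V" "v \<in> V" "card (nbrs V v) = d"
    and "num (V - {v}) \<le> r * growth ^ card V"
    and "real (card (iso_mds V v)) \<le> i * growth ^ card V"
    and "(\<Sum>u\<in>nbrs V v. shrink ^ card (priv V v u)) \<le> s"
    and "r + i + shrink ^ (d + 1) * s \<le> 1"
  shows "num V \<le> growth ^ card V"
proof -
  have "num V \<le> num (V - {v}) + real (card (iso_mds V v)) +
    shrink ^ (d + 1) * (\<Sum>u\<in>nbrs V v. shrink ^ card (priv V v u)) * growth ^ card V"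
    using num_branch[OF assms(1,2)] assms(3) by simp
  also have "\<dots> \<le> r * growth ^ card V + i * growth ^ card V + shrink ^ (d + 1) * s * growth ^ card V"
    using assms shrink_pos growth_pos
    by (intro add_mono mult_right_mono mult_left_mono) auto
  also have "\<dots> = (r + i + shrink ^ (d + 1) * s) * growth ^ card V"
    by (simp add: algebra_simps)
  also have "\<dots> \<le> 1 * growth ^ card V"
    using assms growth_pos by (intro mult_right_mono) auto
  finally show ?thesis by simp
qed

lemma shrink_power_priv_le:
  assumes "finite V" "priv V v u \<noteq> {}"
  shows "shrink ^ card (priv V v u) \<le> shrink"
proof -
  have "1 \<le> card (priv V v u)"
    using assms finite_priv[of V v u] by (auto simp: Suc_le_eq card_gt_0_iff)
  then show ?thesis using shrink_power_antimono[of 1] by simp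
qed

lemma shrink_power_le_1: "shrink ^ k \<le> 1"
  using shrink_power_antimono[of 0 k] by simp

lemma sum_shrink_le: "(\<Sum>u\<in>A. shrink ^ f u) \<le> real (card A)"
  using sum_bounded_above[of A "\<lambda>u. shrink ^ f u" 1] shrink_power_le_1 by simp

text \<open>Crude bounds suffice: q + (d+1) q^(d+1) <= q + 7 q^7 < 1.\<close>

lemma num_degree_ge_6:
  assumes b: "subsets_bounded V" and v: "v \<in> V" "card (nbrs V v) \<ge> 6"
  shows "num V \<le> growth ^ card V"
proof (rule num_branch_le[OF b v(1) refl])
  let ?d = "card (nbrs V v)"
  show "num (V - {v}) \<le> shrink * growth ^ card V" by (rule num_remove_vertex[OF b v(1)])
  show "real (card (iso_mds V v)) \<le> shrink ^ (?d + 1) * growth ^ card V" by (rule iso_le[OF b v(1)])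
  show "(\<Sum>u\<in>nbrs V v. shrink ^ card (priv V v u)) \<le> real ?d" by (rule sum_shrink_le)
  have "real (?d + 1) * shrink ^ (?d + 1) \<le> real 7 * shrink ^ 7"
    using v by (intro linear_shrink_antimono) auto
  then show "shrink + shrink ^ (?d + 1) + shrink ^ (?d + 1) * real ?d \<le> 1"
    using shrink_bounds by (simp add: algebra_simps)
qed

text \<open>The crude bound q + 6 q^6 narrowly exceeds 1. Either some private part is empty and the
  term for isolated \<open>v\<close> vanishes, or every edge branch gains another factor q.\<close>

lemma num_degree_5:
  assumes b: "subsets_bounded V" and v: "v \<in> V" "card (nbrs V v) = 5"
  shows "num V \<le> growth ^ card V"
proof (cases "\<exists>u\<in>nbrs V v. priv V v u = {}")
  case True
  then have "iso_mds V v = {}" using iso_empty by blast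
  then have "real (card (iso_mds V v)) \<le> 0 * growth ^ card V" by simp
  moreover have "shrink + 0 + shrink ^ (5 + 1) * real 5 \<le> 1"
    using shrink_bounds by simp
  ultimately show ?thesis
    using num_branch_le[OF b v num_remove_vertex[OF b v(1)]] sum_shrink_le[of _ "nbrs V v"] v(2)
    by metis
next
  case False
  have fin: "finite V" using b by (simp add: subsets_bounded_def)
  have "(\<Sum>u\<in>nbrs V v. shrink ^ card (priv V v u)) \<le> (\<Sum>u\<in>nbrs V v. shrink)"
    using False fin by (intro sum_mono shrink_power_priv_le) auto
  then have "(\<Sum>u\<in>nbrs V v. shrink ^ card (priv V v u)) \<le> 5 * shrink" using v by simp
  moreover have "shrink + shrink ^ 6 + shrink ^ (5 + 1) * (5 * shrink) \<le> 1"
  proof -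
    have eq: "shrink ^ (5 + 1) * (5 * shrink) = 5 * shrink ^ 7" by (simp add: power_numeral_reduce)
    show ?thesis unfolding eq using shrink_bounds by linarith
  qed
  moreover have "real (card (iso_mds V v)) \<le> shrink ^ 6 * growth ^ card V"
    using iso_le[OF b v(1)] v(2) by simp
  ultimately show ?thesis using num_branch_le[OF b v num_remove_vertex[OF b v(1)]] by blast
qed

text \<open>Here q^5 = 1/10. An empty private part removes the term for isolated \<open>v\<close>,
  but q + 4/10 still exceeds 1, so one edge branch must gain a factor q; this fails only if N[v] is
  a component. If no private part is empty, all four edge branches gain.\<close>

lemma num_degree_4:
  assumes b: "subsets_bounded V" and v: "v \<in> V" "card (nbrs V v) = 4"
  shows "num V \<le> growth ^ card V"
proof -
  have fin: "finite V" using b by (simp add: subsets_bounded_def)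
  have q: "shrink ^ (4 + 1) = 1 / 10" using shrink_power_5 by simp
  consider "\<forall>u\<in>nbrs V v. priv V v u = {}"
    | u w where "u \<in> nbrs V v" "priv V v u = {}" "w \<in> nbrs V v" "priv V v w \<noteq> {}"
    | "\<forall>u\<in>nbrs V v. priv V v u \<noteq> {}" by blast
  then show ?thesis
  proof cases
    case 1
    then show ?thesis using num_universal_component[OF b v(1)] v(2) by simp
  next
    case 2
    then have "iso_mds V v = {}" using iso_empty by blast
    then have "real (card (iso_mds V v)) \<le> 0 * growth ^ card V" by simp
    moreover have "(\<Sum>x\<in>nbrs V v. shrink ^ card (priv V v x)) \<le> shrink + 3"
    proof -
      have "(\<Sum>x\<in>nbrs V v. shrink ^ card (priv V v x)) =
          shrink ^ card (priv V v w) + (\<Sum>x\<in>nbrs V v - {w}. shrink ^ card (priv V v x))"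
        using 2 fin by (intro sum.remove finite_nbrs)
      moreover have "shrink ^ card (priv V v w) \<le> shrink"
        using 2 fin by (intro shrink_power_priv_le)
      moreover have "(\<Sum>x\<in>nbrs V v - {w}. shrink ^ card (priv V v x)) \<le> real (card (nbrs V v - {w}))"
        by (rule sum_shrink_le)
      ultimately show ?thesis using 2 v finite_nbrs[OF fin, of v] by simp
    qed
    moreover have "shrink + 0 + shrink ^ (4 + 1) * (shrink + 3) \<le> 1"
      unfolding q using shrink_bounds(1) by (simp add: field_simps)
    ultimately show ?thesis using num_branch_le[OF b v num_remove_vertex[OF b v(1)]] by blast
  next
    case 3
    have "(\<Sum>u\<in>nbrs V v. shrink ^ card (priv V v u)) \<le> (\<Sum>u\<in>nbrs V v. shrink)"
      using 3 fin by (intro sum_mono shrink_power_priv_le) auto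
    then have "(\<Sum>u\<in>nbrs V v. shrink ^ card (priv V v u)) \<le> 4 * shrink" using v by simp
    moreover have "shrink + shrink ^ (4 + 1) + shrink ^ (4 + 1) * (4 * shrink) \<le> 1"
      unfolding q using shrink_bounds(1) by (simp add: field_simps)
    moreover have "real (card (iso_mds V v)) \<le> shrink ^ (4 + 1) * growth ^ card V"
      using iso_le[OF b v(1)] v(2) by simp
    ultimately show ?thesis using num_branch_le[OF b v num_remove_vertex[OF b v(1)]] by blast
  qed
qed

section \<open>Vertices of degree three\<close>

lemma num_degree_3_priv_empty:
  assumes b: "subsets_bounded V" and v: "v \<in> V" "card (nbrs V v) = 3"
    and deg: "\<And>u. u \<in> V \<Longrightarrow> card (nbrs V u) \<le> 3"
    and a: "a \<in> nbrs V v" "priv V v a = {}"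
  shows "num V \<le> growth ^ card V"
proof (cases "\<forall>u\<in>nbrs V v. priv V v u = {}")
  case True
  then show ?thesis using num_universal_component[OF b v(1)] v(2) by simp
next
  case False
  have fin: "finite V" using b by (simp add: subsets_bounded_def)
  obtain d where d: "d \<in> nbrs V v" "priv V v d \<noteq> {}" using False by blast
  then have "d \<noteq> a" using a by auto
  then obtain c where N: "nbrs V v = {a, d, c}" and ne: "a \<noteq> c" "d \<noteq> c"
    using card_3_with_two[OF v(2) a(1) d(1)] by metis
  have iso: "real (card (iso_mds V v)) \<le> 0 * growth ^ card V"
    using iso_empty[OF a] by simp
  have sum: "(\<Sum>u\<in>nbrs V v. shrink ^ card (priv V v u)) =
      1 + shrink ^ card (priv V v d) + shrink ^ card (priv V v c)"
    using N ne \<open>d \<noteq> a\<close> a(2) by simp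
  have le: "shrink ^ card (priv V v d) \<le> shrink" using d fin by (intro shrink_power_priv_le)
  show ?thesis
  \<comment> \<open>Two nonempty private parts give q + q^4 + 2 q^5 < 1. A single one would give q +
    2 q^4 + q^5 > 1, so deleting \<open>v\<close> must then gain more than the factor q.\<close>
  proof (cases "priv V v c = {}")
    case False
    then have "shrink ^ card (priv V v c) \<le> shrink" using fin by (intro shrink_power_priv_le)
    then have "(\<Sum>u\<in>nbrs V v. shrink ^ card (priv V v u)) \<le> 1 + 2 * shrink" using sum le by simp
    moreover have "shrink + 0 + shrink ^ (3 + 1) * (1 + 2 * shrink) \<le> 1"
    proof -
      have eq: "shrink ^ (3 + 1) * (1 + 2 * shrink) = shrink ^ 4 + 2 * shrink ^ 5"
        by (simp add: algebra_simps power_numeral_reduce)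
      show ?thesis unfolding eq using shrink_bounds by linarith
    qed
    ultimately show ?thesis using num_branch_le[OF b v num_remove_vertex[OF b v(1)] iso] by blast
  next
    case c: True
    \<comment> \<open>If every neighbour had degree 3, then \<open>a\<close> and \<open>c\<close>
      would be adjacent to all the rest of N[v], the neighbours of \<open>d\<close> would be
      \<open>v\<close>, \<open>a\<close>, \<open>c\<close>, and the private part of \<open>d\<close>
      would be empty.\<close>
    have "\<exists>u\<in>nbrs V v. card (nbrs V u) \<le> 2"
    proof (rule ccontr)
      assume "\<not> ?thesis"
      then have ge: "3 \<le> card (nbrs V a)" "3 \<le> card (nbrs V c)" using N by auto
      have "nbrs V a \<subseteq> {v, d, c}" using a(2) N nbrs_irrefl[of a V] by (auto simp: priv_def)
      moreover have "card {v, d, c} \<le> 3" by (simp add: card_insert_if)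
      ultimately have na: "nbrs V a = {v, d, c}" using ge by (intro card_seteq) auto
      have "nbrs V c \<subseteq> {v, d, a}" using c N nbrs_irrefl[of c V] by (auto simp: priv_def)
      moreover have "card {v, d, a} \<le> 3" by (simp add: card_insert_if)
      ultimately have nc: "nbrs V c = {v, d, a}" using ge by (intro card_seteq) auto
      have V: "a \<in> V" "c \<in> V" "d \<in> V" using N nbrs_in[of _ V v] by auto
      have "{v, a, c} \<subseteq> nbrs V d"
        using na nc V v nbrs_sym[of d V a] nbrs_sym[of d V c] nbrs_sym[of d V v] d by auto
      moreover have "card {v, a, c} = 3" using ne N nbrs_irrefl[of v V] by auto
      ultimately have "nbrs V d = {v, a, c}"
        using deg[OF V(3)] finite_nbrs[OF fin] by (intro card_seteq[symmetric]) auto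
      then show False using d(2) N by (auto simp: priv_def)
    qed
    then have r: "num (V - {v}) \<le> (shrink ^ 3 + 2 * shrink ^ 4) * growth ^ card V"
      using num_remove_near_low_degree[OF b v(1)] by blast
    have "(\<Sum>u\<in>nbrs V v. shrink ^ card (priv V v u)) \<le> 2 + shrink" using sum le c by simp
    moreover have "(shrink ^ 3 + 2 * shrink ^ 4) + 0 + shrink ^ (3 + 1) * (2 + shrink) \<le> 1"
    proof -
      have eq: "shrink ^ (3 + 1) * (2 + shrink) = 2 * shrink ^ 4 + shrink ^ 5"
        by (simp add: algebra_simps power_numeral_reduce)
      show ?thesis unfolding eq using shrink_bounds by linarith
    qed
    ultimately show ?thesis using num_branch_le[OF b v r iso] by blast
  qed
qed

text \<open>With all private parts nonempty, three situations remain: a neighbour of degree at most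
  2, which forces a vertex and loses an edge when \<open>v\<close> is deleted; no edge inside N(v),
  where all private parts have two vertices; an edge inside N(v), which yields twins or two forced
  vertices.\<close>

lemma num_degree_3:
  assumes b: "subsets_bounded V" and v: "v \<in> V" "card (nbrs V v) = 3"
    and deg: "\<And>u. u \<in> V \<Longrightarrow> card (nbrs V u) \<le> 3"
  shows "num V \<le> growth ^ card V"
proof (cases "\<exists>u\<in>nbrs V v. priv V v u = {}")
  case True
  then show ?thesis using num_degree_3_priv_empty[OF b v deg] by blast
next
  case p: False
  have fin: "finite V" using b by (simp add: subsets_bounded_def)
  have vin: "v \<in> nbrs V u" if "u \<in> nbrs V v" for u using that v(1) by (rule nbrs_sym)
  have le: "shrink ^ card (priv V v u) \<le> shrink" if "u \<in> nbrs V v" for u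
    using p that fin by (intro shrink_power_priv_le) auto
  have iso4: "real (card (iso_mds V v)) \<le> shrink ^ 4 * growth ^ card V"
    using iso_le[OF b v(1)] v(2) by simp
  show ?thesis
  proof (cases "\<exists>u\<in>nbrs V v. card (nbrs V u) \<le> 2")
    case True
    then obtain u where u: "u \<in> nbrs V v" "card (nbrs V u) \<le> 2" by blast
    \<comment> \<open>One of the at most two neighbours of \<open>u\<close> is \<open>v\<close>, so
      the nonempty private part is a single vertex, forced whenever \<open>v\<close> is
      isolated.\<close>
    have "card (priv V v u) \<le> card (nbrs V u - {v})"
      using finite_nbrs[OF fin] by (intro card_mono) (auto simp: priv_def)
    also have "\<dots> \<le> 1" using u vin[OF u(1)] finite_nbrs[OF fin, of u] by simp
    finally obtain w where w: "priv V v u = {w}"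
      using p u finite_priv[OF fin, of v u] by (auto simp: le_Suc_eq card_1_singleton_iff)
    have iso: "real (card (iso_mds V v)) \<le> (2 * shrink ^ 6) * growth ^ card V"
      using iso_one_forced[OF b v(1) u(1) w] v(2) by (simp add: power_numeral_reduce mult_ac)
    have "(\<Sum>u\<in>nbrs V v. shrink ^ card (priv V v u)) \<le> (\<Sum>u\<in>nbrs V v. shrink)"
      using le by (intro sum_mono)
    then have "(\<Sum>u\<in>nbrs V v. shrink ^ card (priv V v u)) \<le> 3 * shrink" using v by simp
    moreover have "(shrink ^ 3 + 2 * shrink ^ 4) + 2 * shrink ^ 6 + shrink ^ (3 + 1) * (3 * shrink) \<le> 1"
    proof -
      have eq: "shrink ^ (3 + 1) * (3 * shrink) = 3 * shrink ^ 5"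
        by (simp add: algebra_simps power_numeral_reduce)
      show ?thesis unfolding eq using shrink_bounds by linarith
    qed
    ultimately show ?thesis
      using num_branch_le[OF b v num_remove_near_low_degree[OF b v(1) u] iso] by blast
  next
    case False
    have deg3: "card (nbrs V u) = 3" if "u \<in> nbrs V v" for u
      using False that deg[OF nbrs_in[OF that]] by force
    show ?thesis
    proof (cases "\<exists>a\<in>nbrs V v. \<exists>c\<in>nbrs V v. adj a c")
      case False
      have "shrink ^ card (priv V v u) = shrink ^ 2" if u: "u \<in> nbrs V v" for u
      proof -
        have "priv V v u = nbrs V u - {v}" using False u by (auto simp: priv_def nbrs_def)
        then show ?thesis using deg3[OF u] vin[OF u] finite_nbrs[OF fin, of u] by simp
      qed
      then have "(\<Sum>u\<in>nbrs V v. shrink ^ card (priv V v u)) = 3 * shrink ^ 2" using v by simp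
      moreover have "shrink + shrink ^ 4 + shrink ^ (3 + 1) * (3 * shrink ^ 2) \<le> 1"
      proof -
        have eq: "shrink ^ (3 + 1) * (3 * shrink ^ 2) = 3 * shrink ^ 6"
          by (simp add: algebra_simps power_numeral_reduce)
        show ?thesis unfolding eq using shrink_bounds by linarith
      qed
      ultimately show ?thesis
        using num_branch_le[OF b v num_remove_vertex[OF b v(1)] iso4] by (metis order_refl)
    next
      case True
      then obtain a c where ac: "a \<in> nbrs V v" "c \<in> nbrs V v" "adj a c" by blast
      then have ne: "a \<noteq> c" using adj_irrefl by auto
      obtain e where N: "nbrs V v = {a, c, e}" and ne': "a \<noteq> e" "c \<noteq> e"
        using card_3_with_two[OF v(2) ac(1,2) ne] by metis
      have V: "a \<in> V" "c \<in> V" "e \<in> V" using N nbrs_in[of _ V v] by auto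
      have av: "a \<noteq> v" "c \<noteq> v" "e \<noteq> v" using N nbrs_irrefl[of v V] by auto
      have ca: "c \<in> nbrs V a" "a \<in> nbrs V c" using ac adj_sym V by (auto simp: nbrs_def)
      obtain a' where a': "nbrs V a = {v, c, a'}" "a' \<noteq> v" "a' \<noteq> c"
        using card_3_with_two[OF deg3[OF ac(1)] vin[OF ac(1)] ca(1)] av by metis
      obtain c' where c': "nbrs V c = {v, a, c'}" "c' \<noteq> v" "c' \<noteq> a"
        using card_3_with_two[OF deg3[OF ac(2)] vin[OF ac(2)] ca(2)] av by metis
      \<comment> \<open>Two of the three neighbours of \<open>a\<close> are \<open>v\<close> and
        \<open>c\<close>; the nonempty private part must be the third one.\<close>
      have pa: "priv V v a = {a'}" using p ac(1) a' N by (auto simp: priv_def)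
      have pc: "priv V v c = {c'}" using p ac(2) c' N by (auto simp: priv_def)
      show ?thesis
      proof (cases "a' = c'")
        case True
        \<comment> \<open>\<open>a\<close> and \<open>c\<close> are twins here: branch at \<open>a\<close> instead of \<open>v\<close>.\<close>
        have "priv V a c = {}" using a' c' True by (auto simp: priv_def)
        then show ?thesis
          using num_degree_3_priv_empty[OF b V(1) deg3[OF ac(1)] deg ca(1)] by blast
      next
        case False
        have e: "e \<in> nbrs V v" using N by simp
        \<comment> \<open>Private vertices lie outside N(v), hence differ from \<open>e\<close>. So
          \<open>e\<close> is adjacent to neither \<open>a\<close> nor \<open>c\<close> and keeps
          two private neighbours, which supplies the term q^2.\<close>
        have "a' \<noteq> e" "c' \<noteq> e" using pa pc N by (auto simp: priv_def)
        then have "a \<notin> nbrs V e" "c \<notin> nbrs V e"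
          using nbrs_sym[of a V e] nbrs_sym[of c V e] V a' c' ne' av by auto
        then have "priv V v e = nbrs V e - {v}"
          using N nbrs_irrefl[of e V] by (auto simp: priv_def)
        then have "card (priv V v e) = 2" using deg3[OF e] vin[OF e] finite_nbrs[OF fin, of e] by simp
        then have s: "(\<Sum>u\<in>nbrs V v. shrink ^ card (priv V v u)) \<le> 2 * shrink + shrink ^ 2"
          using N ne ne' pa pc by simp
        have iso: "real (card (iso_mds V v)) \<le> (4 * shrink ^ 8) * growth ^ card V"
          using iso_two_forced[OF b v(1) ac(1) pa ac(2) pc False] v(2)
          by (simp add: power_numeral_reduce mult_ac)
        have "shrink + 4 * shrink ^ 8 + shrink ^ (3 + 1) * (2 * shrink + shrink ^ 2) \<le> 1"
        proof -
          have eq: "shrink ^ (3 + 1) * (2 * shrink + shrink ^ 2) = 2 * shrink ^ 5 + shrink ^ 6"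
            by (simp add: algebra_simps power_numeral_reduce)
          show ?thesis unfolding eq using shrink_bounds by linarith
        qed
        then show ?thesis using num_branch_le[OF b v num_remove_vertex[OF b v(1)] iso s] by blast
      qed
    qed
  qed
qed

section \<open>Disjoint unions of cycles\<close>

lemma num_2_regular:
  assumes b: "subsets_bounded V" and v: "v \<in> V" and deg: "\<And>u. u \<in> V \<Longrightarrow> card (nbrs V u) = 2"
  shows "num V \<le> growth ^ card V"
proof -
  have fin: "finite V" using b by (simp add: subsets_bounded_def)
  have other: "\<exists>z. nbrs V y = {x, z} \<and> z \<noteq> x \<and> z \<in> V \<and> z \<noteq> y" if "y \<in> V" "x \<in> nbrs V y" for x y
  proof -
    have "card (nbrs V y - {x}) = 1" using deg[OF that(1)] that finite_nbrs[OF fin, of y] by simp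
    then obtain z where z: "nbrs V y - {x} = {z}" by (auto simp: card_1_singleton_iff)
    then have "nbrs V y = {x, z}" "z \<noteq> x" "z \<in> nbrs V y" using that by auto
    then show ?thesis using nbrs_in nbrs_irrefl by metis
  qed
  have b1: "subsets_bounded (V - {v})" by (rule subsets_bounded_mono[OF b]) auto
  have fin1: "finite (V - {v})" using fin by simp
  obtain u w where N: "nbrs V v = {u, w}" and uw: "u \<noteq> w"
    using deg[OF v] by (auto simp: card_2_iff)
  have V: "u \<in> V" "w \<in> V" using N nbrs_in[of _ V v] by auto
  have uv: "u \<noteq> v" "w \<noteq> v" using N nbrs_irrefl[of v V] by auto
  have vu: "v \<in> nbrs V u" "v \<in> nbrs V w" using N v nbrs_sym by blast+
  obtain u' where u': "nbrs V u = {v, u'}" "u' \<noteq> v" "u' \<in> V" "u' \<noteq> u" using other[OF V(1) vu(1)] by blast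
  obtain w' where w': "nbrs V w = {v, w'}" "w' \<noteq> v" "w' \<in> V" "w' \<noteq> w" using other[OF V(2) vu(2)] by blast
  have d: "card (nbrs V v) = 2" by (rule deg[OF v])
  show ?thesis
  \<comment> \<open>The cycle through \<open>v\<close> is followed in both directions:
    \<open>u' = w\<close> is a triangle, otherwise \<open>u' = w'\<close> is a 4-cycle, and all
    other cycles have length at least 5.\<close>
  proof (cases "u' = w")
    case True
    then have nw: "nbrs V w = {v, u}" using nbrs_sym[of w V u] u' V uv w' by auto
    have "iso_mds V v = {}"
      using N nw by (intro iso_empty[of w]) (auto simp: priv_def)
    then have iso: "real (card (iso_mds V v)) \<le> 0 * growth ^ card V" by simp
    have n1: "nbrs (V - {v}) u = {w}" "nbrs (V - {v}) w = {u}"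
      using u' nw True uv by (auto simp: nbrs_Diff)
    \<comment> \<open>Without \<open>v\<close> the vertices \<open>u\<close> and \<open>w\<close>
      form a component, which lies in every maximal set; only the branch deleting both
      remains.\<close>
    have "iso_mds (V - {v}) u = {}"
      using n1 by (intro iso_empty[of w]) (auto simp: priv_def)
    then have "card (mds (V - {v})) \<le> card (mds (V - {v} - closed_nbhd {w, u}))"
      using card_leaf[OF fin1 _ n1(1)] n1 V uv by simp
    also have "V - {v} - closed_nbhd {w, u} = V - ({v} \<union> closed_nbhd {w, u})" by auto
    finally have "num (V - {v}) \<le> num (V - ({v} \<union> closed_nbhd {w, u}))" by simp
    also have "\<dots> \<le> shrink ^ 3 * growth ^ card V"
    proof (rule num_Diff_le[OF b])
      have "card {v, w, u} \<le> card (V \<inter> ({v} \<union> closed_nbhd {w, u}))"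
        using fin v V by (intro card_mono) (auto simp: closed_nbhd_def)
      then show "3 \<le> card (V \<inter> ({v} \<union> closed_nbhd {w, u}))" using uv uw by simp
    qed simp
    finally have r: "num (V - {v}) \<le> shrink ^ 3 * growth ^ card V" .
    have "shrink ^ 3 + 0 + shrink ^ (2 + 1) * real 2 \<le> 1" using shrink_bounds by simp
    then show ?thesis
      using num_branch_le[OF b v d r iso] sum_shrink_le[of _ "nbrs V v"] d by metis
  next
    case False
    then have "u \<notin> nbrs V w" using nbrs_sym[of u V w] u' uv V by auto
    then have w'u: "w' \<noteq> u" using w' by auto
    have pu: "priv V v u = {u'}" and pw: "priv V v w = {w'}"
      using u' w' N False w'u by (auto simp: priv_def)
    have uN: "u \<in> nbrs V v" "w \<in> nbrs V v" using N by auto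
    show ?thesis
    proof (cases "u' = w'")
      case True
      have "u \<in> nbrs V u'" "w \<in> nbrs V u'"
        using u' w' V True nbrs_sym[of u' V u] nbrs_sym[of w' V w] by auto
      then have nu': "nbrs V u' = {u, w}" using other[OF u'(3)] uw by blast
      have card4: "card {v, u, w, u'} = 4" using uv uw u' False by auto
      have CV: "{v, u, w, u'} \<subseteq> V" using v V u' by auto
      show ?thesis
      proof (rule num_component[OF b CV])
        show "nbrs V x \<subseteq> {v, u, w, u'}" if "x \<in> {v, u, w, u'}" for x
          using that N u' w' nu' True by auto
        show "num {v, u, w, u'} \<le> growth ^ card {v, u, w, u'}"
        proof (rule num_square[of _ v u w u'])
          show "subsets_bounded {v, u, w, u'}" using b CV by (rule subsets_bounded_mono)
          have eq: "nbrs {v, u, w, u'} x = nbrs V x \<inter> {v, u, w, u'}" for x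
            using CV by (auto simp: nbrs_def)
          show "nbrs {v, u, w, u'} v = {u, w}" "u' \<in> nbrs {v, u, w, u'} u" "u' \<in> nbrs {v, u, w, u'} w"
            unfolding eq using N u' w' True by auto
        qed (use card4 in auto)
      qed simp
    next
      case ne: False
      have "u \<in> nbrs V u'" using u' V nbrs_sym[of u' V u] by auto
      then obtain z where z: "nbrs V u' = {u, z}" "z \<noteq> u" "z \<in> V" "z \<noteq> u'"
        using other[OF u'(3)] by blast
      have "z \<noteq> v" using nbrs_sym[of z V u'] z u' N False by auto
      have "z \<noteq> w" using nbrs_sym[of z V u'] z u' w' ne by auto
      have "u' \<in> nbrs V z" using z u' nbrs_sym[of z V u'] by auto
      then obtain y where y: "nbrs V z = {u', y}" "y \<noteq> u'" "y \<in> V" "y \<noteq> z"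
        using other[OF z(3)] by blast
      have zy: "z \<in> nbrs V y" using y z nbrs_sym[of y V z] by auto
      have "y \<noteq> v" using zy N z(2) \<open>z \<noteq> w\<close> by auto
      have "y \<noteq> u" using zy u' \<open>z \<noteq> v\<close> z(4) by auto
      have adjs: "adj u' z" "adj u' u" "adj z y"
        using z y by (auto simp: nbrs_def)
      have n1: "nbrs (V - {v}) u = {u'}" "nbrs (V - {v}) u' = {u, z}"
        using u' z uv \<open>z \<noteq> v\<close> by (auto simp: nbrs_Diff)
      have u1: "u \<in> V - {v}" using V uv by auto
      have sw: "V - {v} - A = V - ({v} \<union> A)" for A by auto
      \<comment> \<open>On the path \<open>v\<close>, \<open>u\<close>, \<open>u'\<close>,
        \<open>z\<close>, \<open>y\<close> the vertex \<open>u\<close> becomes a leaf at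
        \<open>u'\<close>. The general leaf factor would be too weak here; counting in each branch
        gives at least 3, 4 and 5 deleted vertices, including \<open>v\<close>.\<close>
      have "num (V - {v}) \<le> real (card (iso_mds (V - {v}) u)) +
          num (V - ({v} \<union> closed_nbhd {u', u})) + num (V - ({v} \<union> closed_nbhd {u', z}))"
      proof -
        have "card (mds (V - {v})) \<le> card (iso_mds (V - {v}) u) +
            (card (mds (V - {v} - closed_nbhd {u', u})) + card (mds (V - {v} - closed_nbhd {u', z})))"
          using card_leaf[OF fin1 u1 n1(1)] n1(2) z(2) by simp
        then show ?thesis unfolding sw by linarith
      qed
      also have "real (card (iso_mds (V - {v}) u)) \<le> shrink ^ 3 * growth ^ card V"
      proof -
        have "real (card (iso_mds (V - {v}) u)) \<le> shrink ^ 2 * growth ^ card (V - {v})"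
          using iso_le[OF b1 u1] n1(1) by (simp add: numeral_2_eq_2)
        also have "\<dots> \<le> shrink ^ 2 * (shrink ^ 1 * growth ^ card V)"
          using fin v shrink_pos by (intro mult_left_mono growth_Diff_le) auto
        finally show ?thesis by (simp add: power_numeral_reduce mult_ac)
      qed
      also have "num (V - ({v} \<union> closed_nbhd {u', u})) \<le> shrink ^ 4 * growth ^ card V"
      proof (rule num_Diff_le[OF b])
        have "card {v, u', u, z} \<le> card (V \<inter> ({v} \<union> closed_nbhd {u', u}))"
          using fin v V u' z adjs by (intro card_mono) (auto simp: closed_nbhd_def)
        then show "4 \<le> card (V \<inter> ({v} \<union> closed_nbhd {u', u}))"
          using uv u' z \<open>z \<noteq> v\<close> by auto
      qed simp
      also have "num (V - ({v} \<union> closed_nbhd {u', z})) \<le> shrink ^ 5 * growth ^ card V"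
      proof (rule num_Diff_le[OF b])
        \<comment> \<open>In a 5-cycle \<open>y\<close> equals \<open>w\<close>; only its
          distinctness from the other four vertices matters.\<close>
        have "card {v, u', u, z, y} \<le> card (V \<inter> ({v} \<union> closed_nbhd {u', z}))"
          using fin v V u' z y adjs by (intro card_mono) (auto simp: closed_nbhd_def)
        moreover have "card {v, u', u, z, y} = 5"
          using uv u' z y \<open>z \<noteq> v\<close> \<open>y \<noteq> v\<close> \<open>y \<noteq> u\<close> by auto
        ultimately show "5 \<le> card (V \<inter> ({v} \<union> closed_nbhd {u', z}))" by simp
      qed simp
      finally have r: "num (V - {v}) \<le> (shrink ^ 3 + shrink ^ 4 + shrink ^ 5) * growth ^ card V"
        by (simp add: algebra_simps)
      have iso: "real (card (iso_mds V v)) \<le> (4 * shrink ^ 7) * growth ^ card V"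
        using iso_two_forced[OF b v uN(1) pu uN(2) pw ne] d
        by (simp add: power_numeral_reduce mult_ac)
      have s: "(\<Sum>u\<in>nbrs V v. shrink ^ card (priv V v u)) \<le> 2 * shrink"
        using N uw pu pw by simp
      have "(shrink ^ 3 + shrink ^ 4 + shrink ^ 5) + 4 * shrink ^ 7 + shrink ^ (2 + 1) * (2 * shrink) \<le> 1"
      proof -
        have eq: "shrink ^ (2 + 1) * (2 * shrink) = 2 * shrink ^ 4"
          by (simp add: algebra_simps power_numeral_reduce)
        show ?thesis unfolding eq using shrink_bounds by linarith
      qed
      then show ?thesis using num_branch_le[OF b v d r iso s] by blast
    qed
  qed
qed

section \<open>Induction over vertex sets\<close>

theorem num_le_growth:
  assumes "finite V"
  shows "num V \<le> growth ^ card V"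
  using assms
proof (induction V rule: finite_psubset_induct)
  case (psubset V)
  then have b: "subsets_bounded V" by (auto simp: subsets_bounded_def)
  have fin: "finite V" by fact
  have mult_le: "c * growth ^ card V \<le> growth ^ card V" if "c \<le> 1" for c
    using mult_right_mono[OF that, of "growth ^ card V"] growth_pos by simp
  \<comment> \<open>Degrees at least 4 and at most 1 are treated wherever they occur. Degree 3 is
    used only when no larger degree is present, and in what remains all degrees equal 2.\<close>
  consider "V = {}" | v where "v \<in> V" "card (nbrs V v) \<ge> 6"
    | v where "v \<in> V" "card (nbrs V v) = 5" | v where "v \<in> V" "card (nbrs V v) = 4"
    | v where "v \<in> V" "card (nbrs V v) = 0" | v where "v \<in> V" "card (nbrs V v) = 1"
    | v where "v \<in> V" "card (nbrs V v) = 3" "\<forall>u\<in>V. card (nbrs V u) \<le> 3"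
    | v where "v \<in> V" "\<forall>u\<in>V. card (nbrs V u) = 2"
  proof -
    have "k \<ge> 6 \<or> k = 5 \<or> k = 4 \<or> k = 0 \<or> k = 1 \<or> k = 3 \<or> k = 2" for k :: nat by arith
    then show thesis using that by (metis all_not_in_conv le_refl numeral_le_iff semiring_norm(69,72) zero_le one_le_numeral)
  qed
  then show ?case
  proof cases
    case 1
    then show ?thesis by (simp add: card_mds_empty)
  next
    case 2
    then show ?thesis by (rule num_degree_ge_6[OF b])
  next
    case 3
    then show ?thesis by (rule num_degree_5[OF b])
  next
    case 4
    then show ?thesis by (rule num_degree_4[OF b])
  next
    case (5 v)
    then have "nbrs V v = {}" using finite_nbrs[OF fin] by simp
    then show ?thesis
      using num_isolated[OF b 5(1)] mult_le[OF shrink_le_1] by linarith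
  next
    case (6 v)
    then obtain a where "nbrs V v = {a}" by (auto simp: card_1_singleton_iff)
    then show ?thesis
      using num_leaf[OF b 6(1)] mult_le[of "shrink ^ 2 + 2 * shrink ^ 3"] shrink_bounds by fastforce
  next
    case 7
    then show ?thesis using num_degree_3[OF b] by blast
  next
    case 8
    then show ?thesis using num_2_regular[OF b] by blast
  qed
qed

end

section \<open>Transfer to pair graphs\<close>

lemma adjacency_parcs: "pair_graph G \<Longrightarrow> adjacency (\<lambda>u v. (u, v) \<in> parcs G)"
proof -
  assume "pair_graph G"
  then interpret pair_graph G .
  show ?thesis
    using pair_sym_arcs by unfold_locales (auto simp: symmetric_def sym_def dest: pair_no_loops)
qed

lemma bounded_degree_sets_1:
  assumes G: "pair_graph G"
  shows "bounded_degree_sets 1 G =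
    {S. S \<subseteq> pverts G \<and> adjacency.dissoc (\<lambda>u v. (u, v) \<in> parcs G) S}"
proof -
  interpret adjacency "\<lambda>u v. (u, v) \<in> parcs G" by (rule adjacency_parcs[OF G])
  have fin: "finite (pverts G)" using G by (rule pair_graph_finite_verts)
  have "max_degree (with_proj G \<restriction> S) \<le> 1 \<longleftrightarrow> dissoc S" if S: "S \<subseteq> pverts G" for S
  proof -
    have finS: "finite S" using S fin by (rule finite_subset)
    have "max_degree (with_proj G \<restriction> S) \<le> 1 \<longleftrightarrow>
        (\<forall>v\<in>S. card {u \<in> S. v \<in> S \<and> (v, u) \<in> parcs G} \<le> 1)"
      using finS by (subst max_degree_le_iff) (simp_all add: out_degree_with_proj_induce)
    also have "\<dots> \<longleftrightarrow> dissoc S"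
      using finS by (auto simp: dissoc_def card_le_Suc0_iff_eq)
    finally show ?thesis .
  qed
  then show ?thesis by (auto simp: bounded_degree_sets_def)
qed

text \<open>If a larger dissociation set exists, adding any one of its new vertices to
  \<open>S\<close> already gives one. So the one-vertex test in \<open>mds\<close> agrees with
  inclusion-maximality.\<close>

lemma maximal_bounded_degree_sets_1:
  assumes G: "pair_graph G"
  shows "maximal_bounded_degree_sets 1 G = adjacency.mds (\<lambda>u v. (u, v) \<in> parcs G) (pverts G)"
proof -
  interpret adjacency "\<lambda>u v. (u, v) \<in> parcs G" by (rule adjacency_parcs[OF G])
  have eq: "(\<exists>T. T \<subseteq> pverts G \<and> dissoc T \<and> S \<subset> T) \<longleftrightarrow> (\<exists>w\<in>pverts G - S. dissoc (insert w S))"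
    if S: "S \<subseteq> pverts G" for S
  proof
    assume "\<exists>T. T \<subseteq> pverts G \<and> dissoc T \<and> S \<subset> T"
    then obtain T w where T: "T \<subseteq> pverts G" "dissoc T" "S \<subset> T" "w \<in> T - S" by blast
    then have "dissoc (insert w S)" by (intro dissoc_subset[OF T(2)]) auto
    then show "\<exists>w\<in>pverts G - S. dissoc (insert w S)" using T by blast
  next
    assume "\<exists>w\<in>pverts G - S. dissoc (insert w S)"
    then show "\<exists>T. T \<subseteq> pverts G \<and> dissoc T \<and> S \<subset> T" using S by blast
  qed
  have "S \<in> maximal_bounded_degree_sets 1 G \<longleftrightarrow> S \<in> mds (pverts G)" for S
    using eq[of S] unfolding maximal_bounded_degree_sets_def bounded_degree_sets_1[OF G] mds_def
    by blast
  then show ?thesis by blast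
qed

lemma card_maximal_bounded_degree_sets_1_le:
  assumes G: "pair_graph G"
  shows "real (card (maximal_bounded_degree_sets 1 G)) \<le> 10 powr (real (card (pverts G)) / 5)"
  unfolding maximal_bounded_degree_sets_1[OF G] growth_power[symmetric]
  using adjacency.num_le_growth[OF adjacency_parcs[OF G] pair_graph_finite_verts[OF G]] .

theorem theorem7:
  fixes N :: nat
  shows "(\<forall>G :: 'a pair_pre_digraph. pair_graph G \<and> card (pverts G) = N \<longrightarrow>
            real (card (maximal_bounded_degree_sets 1 G)) \<le> 10 powr (real N / 5)) \<and>
         real (\<M>\<^bsub>1\<^esub>(N)) \<le> 10 powr (real N / 5) \<and>
         10 powr (real N / 5) \<le> (1.585 :: real) ^ N"
proof (intro conjI allI impI)
  show "real (card (maximal_bounded_degree_sets 1 G)) \<le> 10 powr (real N / 5)"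
    if "pair_graph G \<and> card (pverts G) = N" for G :: "'a pair_pre_digraph"
    using that card_maximal_bounded_degree_sets_1_le by blast
  \<comment> \<open>The maximum is attained, so it is the count of an actual graph on natural
    numbers, and the bound for single graphs applies.\<close>
  have "\<M>\<^bsub>1\<^esub>(N) \<in> graph_counts 1 N"
    unfolding max_count_def by (intro Max_in finite_graph_counts graph_counts_nonempty)
  then show "real (\<M>\<^bsub>1\<^esub>(N)) \<le> 10 powr (real N / 5)"
    using card_maximal_bounded_degree_sets_1_le by (auto simp: graph_counts_def)
  show "10 powr (real N / 5) \<le> (1.585 :: real) ^ N"
    unfolding growth_power[symmetric] using growth_le growth_pos by (intro power_mono) auto
qed

end
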